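(* Let $p\in\mathbb C[z,w]$ be an irreducible inner toral polynomial of bidegree $(n,m)$ and let $\alpha$ be a positive integer. If $\mathcal K$ is a rank $\alpha$-admissible kernel function defined on $\mathfrak V(p)$ and $S=M_z$, $T=M_w$ are the operators of multiplication by $z$ and $w$ respectively on $H^2(\mathcal K)$, then the pair $(S,T)$ is nearly $\alpha$-cyclic.
   Context: Let $\mathbb D$, $\mathbb T$, $\mathbb E$ be the open unit disk, the unit circle, and the complement of the closed unit disk in $\mathbb C$. $Z(p)$ is the zero set of $p$; $p$ is inner toral if $Z(p)\subset\mathbb D^2\cup\mathbb T^2\cup\mathbb E^2$; $\mathfrak V(p)=Z(p)\cap\mathbb D^2$. Bidegree $(n,m)$ means degree $n$ in $z$ and degree $m$ in $w$. A rank $\alpha$-admissible kernel $\mathcal K$ over $\mathfrak V(p)$ consists of an $\alpha\times m\alpha$ matrix polynomial $Q$ and an $\alpha\times n\alpha$ matrix polynomial $P$ such that $$\frac{Q(z,w)Q(\zeta,\eta)^*}{1-z\overline{\zeta}}=\mathcal K((z,w),(\zeta,\eta))=\frac{P(z,w)P(\zeta,\eta)^*}{1-w\overline{\eta}},\qquad (z,w),(\zeta,\eta)\in\mathfrak V(p),$$ where $Q$ and $P$ have full rank $\alpha$ at some point of $\mathfrak V(p)$. $H^2(\mathcal K)$ is the reproducing kernel Hilbert space of $\mathbb C^\alpha$-valued functions on $\mathfrak V(p)$ associated with $\mathcal K$. Multiplication by $z$ and by $w$ are bounded operators on $H^2(\mathcal K)$, and they form a commuting pair of pure isometries (an isometry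 $S$ on $H$ is pure if $\bigcap_{j\ge1}S^jH=\{0\}$). Cyclicity: a commuting pair $V=(S,T)$ of isometries on $H$ is at most nearly $k$-cyclic if there are distinct $f_1,\dots,f_k\in H$ such that the closure of $\{\sum_{j=1}^k q_j(S,T)f_j: q_j\in\mathbb C[z,w]\}$ has finite codimension in $H$. It is at least nearly $k$-cyclic if for every $l<k$ and all $f_1,\dots,f_l\in H$ the closure of $\{\sum_{j=1}^l q_j(S,T)f_j: q_j\in\mathbb C[z,w]\}$ does not have finite codimension in $H$. It is nearly $k$-cyclic if it is both at most and at least nearly $k$-cyclic. *)

theory Defs
  imports
    "HOL-Analysis.Analysis"
    "HOL-Library.Function_Algebras"
    "HOL-Computational_Algebra.Polynomial"
begin

section \<open>Bivariate polynomials and inner toral varieties\<close>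

text \<open>
  An element of \<open>\<complex>[z,w]\<close> is represented as an element of \<open>\<complex>[z][w]\<close>, i.e. the outer variable is
  \<open>w\<close> and the coefficients are polynomials in \<open>z\<close>. Accordingly, \<open>coeff (coeff p i) j\<close> is
  the coefficient of \<open>z\<^sup>j w\<^sup>i\<close>.
\<close>

definition eval2 :: "complex poly poly \<Rightarrow> complex \<times> complex \<Rightarrow> complex" where
  "eval2 p x = poly (poly p [:snd x:]) (fst x)"

definition degree_z :: "complex poly poly \<Rightarrow> nat" where
  "degree_z p = Max ((\<lambda>i. degree (coeff p i)) ` {..degree p})"

definition has_bidegree :: "complex poly poly \<Rightarrow> nat \<Rightarrow> nat \<Rightarrow> bool" where
  "has_bidegree p n m \<longleftrightarrow> degree_z p = n \<and> degree p = m"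

definition zero_set :: "complex poly poly \<Rightarrow> (complex \<times> complex) set" where
  "zero_set p = {x. eval2 p x = 0}"

definition inner_toral :: "complex poly poly \<Rightarrow> bool" where
  "inner_toral p \<longleftrightarrow>
     zero_set p \<subseteq> ball 0 1 \<times> ball 0 1 \<union> sphere 0 1 \<times> sphere 0 1 \<union> (- cball 0 1) \<times> (- cball 0 1)"

definition variety :: "complex poly poly \<Rightarrow> (complex \<times> complex) set" where
  "variety p = zero_set p \<inter> ball 0 1 \<times> ball 0 1"


section \<open>Admissible kernels\<close>

definition eval_mat :: "complex poly poly ^ 'b ^ 'a \<Rightarrow> complex \<times> complex \<Rightarrow> complex ^ 'b ^ 'a" where
  "eval_mat A x = (\<chi> i j. eval2 (A $ i $ j) x)"

definition adj_mat :: "complex ^ 'b ^ 'a \<Rightarrow> complex ^ 'a ^ 'b" where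
  "adj_mat A = (\<chi> i j. cnj (A $ j $ i))"

text \<open>
  For \<open>p\<close> of bidegree \<open>(n, m)\<close>; \<open>Q\<close> is an \<open>\<alpha> \<times> m\<alpha>\<close> and \<open>P\<close> an \<open>\<alpha> \<times> n\<alpha>\<close> matrix, the sizes being
  expressed by the cardinalities of the index types. Only the values of \<open>K\<close> on
  \<open>variety p \<times> variety p\<close> are constrained.
\<close>

definition admissible_kernel ::
  "complex poly poly \<Rightarrow> nat \<Rightarrow> nat \<Rightarrow> nat \<Rightarrow> complex poly poly ^ 'b ^ 'a \<Rightarrow> complex poly poly ^ 'c ^ 'a \<Rightarrow>
   (complex \<times> complex \<Rightarrow> complex \<times> complex \<Rightarrow> complex ^ 'a ^ 'a) \<Rightarrow> bool" where
  "admissible_kernel p n m \<alpha> Q P K \<longleftrightarrow>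
     CARD('a) = \<alpha> \<and> CARD('b) = m * \<alpha> \<and> CARD('c) = n * \<alpha> \<and>
     (\<forall>x\<in>variety p. \<forall>y\<in>variety p. \<forall>i j.
        K x y $ i $ j = (eval_mat Q x ** adj_mat (eval_mat Q y)) $ i $ j / (1 - fst x * cnj (fst y)) \<and>
        K x y $ i $ j = (eval_mat P x ** adj_mat (eval_mat P y)) $ i $ j / (1 - snd x * cnj (snd y))) \<and>
     (\<exists>x\<in>variety p. rank (eval_mat Q x) = \<alpha>) \<and>
     (\<exists>x\<in>variety p. rank (eval_mat P x) = \<alpha>)"


section \<open>Complex Hilbert spaces with explicit carrier\<close>

text \<open>The inner product is linear in the first and conjugate-linear in the second argument.\<close>

locale complex_inner_space = vector_space scale
  for scale :: "complex \<Rightarrow> 'h::ab_group_add \<Rightarrow> 'h" +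
  fixes H :: "'h set" and ip :: "'h \<Rightarrow> 'h \<Rightarrow> complex"
  assumes subspace_H: "subspace H"
    and ip_add: "\<lbrakk>f \<in> H; g \<in> H; h \<in> H\<rbrakk> \<Longrightarrow> ip (f + g) h = ip f h + ip g h"
    and ip_scale: "\<lbrakk>f \<in> H; g \<in> H\<rbrakk> \<Longrightarrow> ip (scale c f) g = c * ip f g"
    and ip_cnj: "\<lbrakk>f \<in> H; g \<in> H\<rbrakk> \<Longrightarrow> ip g f = cnj (ip f g)"
    and ip_pos: "\<lbrakk>f \<in> H; f \<noteq> 0\<rbrakk> \<Longrightarrow> 0 < Re (ip f f)"
begin

definition hnorm :: "'h \<Rightarrow> real" where
  "hnorm f = sqrt (Re (ip f f))"

text \<open>The value outside \<open>H\<close> is irrelevant, but \<^locale>\<open>Metric_space\<close> requires nonnegativity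
  and symmetry on the whole type.\<close>

definition hdist :: "'h \<Rightarrow> 'h \<Rightarrow> real" where
  "hdist f g = (if f \<in> H \<and> g \<in> H then hnorm (f - g) else 0)"

lemma ip_add_right: "\<lbrakk>f \<in> H; g \<in> H; h \<in> H\<rbrakk> \<Longrightarrow> ip h (f + g) = ip h f + ip h g"
  by (metis complex_cnj_add ip_add ip_cnj subspace_H subspace_add)

lemma ip_scale_right: "\<lbrakk>f \<in> H; g \<in> H\<rbrakk> \<Longrightarrow> ip g (scale c f) = cnj c * ip g f"
  by (metis complex_cnj_mult ip_scale ip_cnj subspace_H subspace_scale)

lemma ip_zero: "ip 0 0 = 0"
  using ip_scale[of 0 0 0] subspace_0[OF subspace_H] by simp

lemma ip_nonneg: "f \<in> H \<Longrightarrow> 0 \<le> Re (ip f f)"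
  using ip_pos[of f] ip_zero by (cases "f = 0") auto

lemma ip_self: "f \<in> H \<Longrightarrow> ip f f = complex_of_real ((hnorm f)\<^sup>2)"
  using ip_cnj[of f f] ip_nonneg[of f] unfolding hnorm_def
  by (simp add: complex_eq_iff)

lemma Cauchy_Schwarz:
  assumes f: "f \<in> H" and g: "g \<in> H"
  shows "cmod (ip f g) \<le> hnorm f * hnorm g"
proof (cases "g = 0")
  case True
  have "ip g f = 0"
    using True ip_scale[OF subspace_0[OF subspace_H] f, of 0] by simp
  then have "ip f g = 0"
    using ip_cnj[OF g f] by simp
  then show ?thesis
    using True ip_nonneg[OF f] ip_nonneg[OF g] by (simp add: hnorm_def)
next
  case False
  define G where "G = Re (ip g g)"
  have G: "0 < G" "ip g g = of_real G"
    using ip_pos[OF g False] ip_self[OF g] by (auto simp: G_def)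
  define c where "c = - (ip f g / of_real G)"
  have cg: "scale c g \<in> H" using g subspace_H subspace_scale by blast
  have "ip (f + scale c g) (f + scale c g)
      = ip f f + cnj c * ip f g + c * ip g f + c * cnj c * ip g g"
    using f g cg subspace_add[OF subspace_H f cg]
    by (simp add: ip_add ip_add_right ip_scale ip_scale_right algebra_simps)
  also have "\<dots> = ip f f - ip f g * cnj (ip f g) / of_real G"
    using G ip_cnj[OF f g] by (simp add: c_def field_simps)
  also have "\<dots> = ip f f - of_real ((cmod (ip f g))\<^sup>2 / G)"
    by (simp flip: complex_norm_square)
  finally have "0 \<le> Re (ip f f) - (cmod (ip f g))\<^sup>2 / G"
    using ip_nonneg[OF subspace_add[OF subspace_H f cg]] by simp
  then have "(cmod (ip f g))\<^sup>2 \<le> Re (ip f f) * G"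
    using G by (simp add: field_simps)
  then have "cmod (ip f g) \<le> sqrt (Re (ip f f) * G)"
    by (rule real_le_rsqrt)
  then show ?thesis
    by (simp add: hnorm_def G_def real_sqrt_mult)
qed

lemma hnorm_nonneg: "f \<in> H \<Longrightarrow> 0 \<le> hnorm f"
  by (simp add: hnorm_def ip_nonneg)

lemma hnorm_triangle:
  assumes f: "f \<in> H" and g: "g \<in> H"
  shows "hnorm (f + g) \<le> hnorm f + hnorm g"
proof -
  have fg: "f + g \<in> H" using f g subspace_H subspace_add by blast
  have "(hnorm (f + g))\<^sup>2 = Re (ip (f + g) (f + g))"
    using ip_nonneg[OF fg] by (simp add: hnorm_def)
  also have "\<dots> = Re (ip f f) + 2 * Re (ip f g) + Re (ip g g)"
    using f g fg ip_cnj[OF f g] by (simp add: ip_add ip_add_right)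
  also have "\<dots> \<le> (hnorm f)\<^sup>2 + 2 * (hnorm f * hnorm g) + (hnorm g)\<^sup>2"
    using Cauchy_Schwarz[OF f g] complex_Re_le_cmod[of "ip f g"]
      ip_nonneg[OF f] ip_nonneg[OF g] by (simp add: hnorm_def)
  also have "\<dots> = (hnorm f + hnorm g)\<^sup>2"
    by (simp add: power2_eq_square algebra_simps)
  finally show ?thesis
    by (rule power2_le_imp_le) (use hnorm_nonneg[OF f] hnorm_nonneg[OF g] in simp)
qed

lemma hnorm_minus: "f \<in> H \<Longrightarrow> hnorm (- f) = hnorm f"
  using ip_scale[of f "scale (-1) f" "-1"] ip_scale_right[of f f "-1"]
    subspace_scale[OF subspace_H, of f "-1"]
  by (simp add: hnorm_def)

sublocale Metric_space H hdist
proof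
  show "0 \<le> hdist f g" for f g
    using hnorm_nonneg subspace_diff[OF subspace_H] by (simp add: hdist_def)
  show "hdist f g = hdist g f" for f g
    using hnorm_minus[of "f - g"] subspace_diff[OF subspace_H] by (auto simp: hdist_def)
  show "hdist f g = 0 \<longleftrightarrow> f = g" if "f \<in> H" "g \<in> H" for f g
    using that ip_pos[of "f - g"] ip_zero subspace_diff[OF subspace_H]
    by (force simp: hdist_def hnorm_def)
  show "hdist f h \<le> hdist f g + hdist g h" if "f \<in> H" "g \<in> H" "h \<in> H" for f g h
    using that hnorm_triangle[of "f - g" "g - h"] subspace_diff[OF subspace_H]
    by (simp add: hdist_def)
qed

end

locale complex_hilbert_space = complex_inner_space scale H ip
  for scale :: "complex \<Rightarrow> 'h::ab_group_add \<Rightarrow> 'h" and H :: "'h set" and ip :: "'h \<Rightarrow> 'h \<Rightarrow> complex" +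
  assumes complete_H: "mcomplete"


section \<open>Nearly cyclic pairs of isometries\<close>

context complex_hilbert_space
begin

definition isometric_operator :: "('h \<Rightarrow> 'h) \<Rightarrow> bool" where
  "isometric_operator S \<longleftrightarrow>
     (\<forall>f\<in>H. S f \<in> H) \<and>
     (\<forall>f\<in>H. \<forall>g\<in>H. S (f + g) = S f + S g) \<and>
     (\<forall>c. \<forall>f\<in>H. S (scale c f) = scale c (S f)) \<and>
     (\<forall>f\<in>H. hnorm (S f) = hnorm f)"

definition commuting_isometries :: "('h \<Rightarrow> 'h) \<Rightarrow> ('h \<Rightarrow> 'h) \<Rightarrow> bool" where
  "commuting_isometries S T \<longleftrightarrow>
     isometric_operator S \<and> isometric_operator T \<and> (\<forall>f\<in>H. S (T f) = T (S f))"

text \<open>The operator \<open>q(S,T)\<close>, with \<open>S\<close> substituted for \<open>z\<close> and \<open>T\<close> for \<open>w\<close>.\<close>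

definition poly_op :: "complex poly poly \<Rightarrow> ('h \<Rightarrow> 'h) \<Rightarrow> ('h \<Rightarrow> 'h) \<Rightarrow> 'h \<Rightarrow> 'h" where
  "poly_op q S T f =
     (\<Sum>i\<le>degree q. \<Sum>j\<le>degree (coeff q i). scale (coeff (coeff q i) j) ((S ^^ j) ((T ^^ i) f)))"

definition cyclic_span :: "('h \<Rightarrow> 'h) \<Rightarrow> ('h \<Rightarrow> 'h) \<Rightarrow> nat \<Rightarrow> (nat \<Rightarrow> 'h) \<Rightarrow> 'h set" where
  "cyclic_span S T k f = {\<Sum>j<k. poly_op (q j) S T (f j) | q. True}"

text \<open>For a subspace \<open>M\<close> of \<open>H\<close>: the quotient \<open>H / M\<close> is spanned by finitely many classes.\<close>

definition finite_codim :: "'h set \<Rightarrow> bool" where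
  "finite_codim M \<longleftrightarrow> (\<exists>F. finite F \<and> F \<subseteq> H \<and> (\<forall>h\<in>H. \<exists>g\<in>span F. h - g \<in> M))"

definition at_most_nearly_cyclic :: "('h \<Rightarrow> 'h) \<Rightarrow> ('h \<Rightarrow> 'h) \<Rightarrow> nat \<Rightarrow> bool" where
  "at_most_nearly_cyclic S T k \<longleftrightarrow>
     commuting_isometries S T \<and>
     (\<exists>f. inj_on f {..<k} \<and> f ` {..<k} \<subseteq> H \<and>
          finite_codim (mtopology closure_of cyclic_span S T k f))"

definition at_least_nearly_cyclic :: "('h \<Rightarrow> 'h) \<Rightarrow> ('h \<Rightarrow> 'h) \<Rightarrow> nat \<Rightarrow> bool" where
  "at_least_nearly_cyclic S T k \<longleftrightarrow>
     commuting_isometries S T \<and>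
     (\<forall>l<k. \<forall>f. f ` {..<l} \<subseteq> H \<longrightarrow>
          \<not> finite_codim (mtopology closure_of cyclic_span S T l f))"

definition nearly_cyclic :: "('h \<Rightarrow> 'h) \<Rightarrow> ('h \<Rightarrow> 'h) \<Rightarrow> nat \<Rightarrow> bool" where
  "nearly_cyclic S T k \<longleftrightarrow> at_most_nearly_cyclic S T k \<and> at_least_nearly_cyclic S T k"

end


section \<open>Vector-valued reproducing kernel Hilbert spaces\<close>

text \<open>Addition and zero are the pointwise ones of \<^theory>\<open>HOL-Library.Function_Algebras\<close>.\<close>

definition fun_scale :: "complex \<Rightarrow> ('x \<Rightarrow> complex ^ 'a) \<Rightarrow> 'x \<Rightarrow> complex ^ 'a" where
  "fun_scale c f = (\<lambda>x. c *s f x)"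

lemma vector_space_fun_scale: "vector_space fun_scale"
  by unfold_locales
    (simp_all add: fun_scale_def fun_eq_iff vec_eq_iff distrib_left distrib_right mult.assoc)

definition kernel_section ::
  "'x set \<Rightarrow> ('x \<Rightarrow> 'x \<Rightarrow> complex ^ 'a ^ 'a) \<Rightarrow> 'x \<Rightarrow> complex ^ 'a \<Rightarrow> 'x \<Rightarrow> complex ^ 'a" where
  "kernel_section X K y v = (\<lambda>x. if x \<in> X then K x y *v v else 0)"

text \<open>
  Functions on \<open>X\<close> are represented by functions on the whole type that vanish outside \<open>X\<close>.
  By the Moore--Aronszajn theorem, a positive semidefinite kernel \<open>K\<close> on \<open>X\<close> determines \<open>H\<close> and
  \<open>ip\<close> (on \<open>H\<close>) uniquely.
\<close>

locale rkhs = complex_hilbert_space fun_scale H ip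
  for H :: "('x \<Rightarrow> complex ^ 'a) set" and ip +
  fixes X :: "'x set" and K :: "'x \<Rightarrow> 'x \<Rightarrow> complex ^ 'a ^ 'a"
  assumes vanish_outside: "\<lbrakk>f \<in> H; x \<notin> X\<rbrakk> \<Longrightarrow> f x = 0"
    and kernel_section_in: "y \<in> X \<Longrightarrow> kernel_section X K y v \<in> H"
    and reproducing: "\<lbrakk>f \<in> H; y \<in> X\<rbrakk> \<Longrightarrow> ip f (kernel_section X K y v) = (\<Sum>i\<in>UNIV. f y $ i * cnj (v $ i))"

definition mult_z :: "(complex \<times> complex \<Rightarrow> complex ^ 'a) \<Rightarrow> complex \<times> complex \<Rightarrow> complex ^ 'a" where
  "mult_z f = (\<lambda>x. fst x *s f x)"

definition mult_w :: "(complex \<times> complex \<Rightarrow> complex ^ 'a) \<Rightarrow> complex \<times> complex \<Rightarrow> complex ^ 'a" where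
  "mult_w f = (\<lambda>x. snd x *s f x)"

end

theory Submission
  imports Defs "HOL-Computational_Algebra.Polynomial_Factorial" "HOL-Computational_Algebra.Field_as_Ring"
    "HOL-Computational_Algebra.Fundamental_Theorem_Algebra"
begin

text \<open>
  Write \<open>V\<close> for the part of the curve in the bidisc. The argument lives on the fibres of \<open>V\<close> over a
  coordinate. For all but finitely many \<open>z\<close> in the disc, the fibre over \<open>z\<close> consists of exactly \<open>m\<close>
  points, since \<open>p(z, \<cdot>)\<close> has simple roots and inner torality confines them to the disc, and \<open>Q\<close> has full
  rank at each of them. The same holds for \<open>w\<close>, \<open>n\<close> and \<open>P\<close> (\<open>generic_fibres_z\<close>, \<open>generic_fibres_w\<close>).

  \<^emph>\<open>Why multiplication by \<open>z\<close> is isometric.\<close> The identity \<open>(1 - z\<zeta>\<^sup>*) K = Q Q\<^sup>*\<close> makes it contractive, and so is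
  multiplication by \<open>w\<close> (\<open>mul_contraction\<close>). Over a generic \<open>\<zeta>\<close>, powers of \<open>w\<close> separate the \<open>m\<close> points of
  the fibre. Hence the ranges of \<open>Q(x)\<^sup>*\<close>, for \<open>x\<close> in the fibre, are independent subspaces of
  dimension \<open>\<alpha>\<close>, so that they fill the whole \<open>m\<alpha>\<close>-dimensional space (\<open>fibre_spans\<close>). Consequently, for every
  vector \<open>a\<close>, the function \<open>G = Q a / (1 - \<zeta>\<^sup>* z)\<close> is a combination of kernel sections over the fibre; it is an
  eigenvector of the adjoint of multiplication by \<open>z\<close>, and \<open>Q a = G - \<zeta>\<^sup>* z G\<close>. Letting \<open>\<zeta>\<close> tend to \<open>0\<close>
  shows first that \<open>Q a\<close> is orthogonal to the range of multiplication by \<open>z\<close>, and then that this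
  multiplication preserves inner products (\<open>mul_g_isometric\<close>). The same argument with the
  coordinates exchanged treats \<open>w\<close>.

  \<^emph>\<open>Why \<open>\<alpha>\<close> generators suffice.\<close> The functions \<open>z\<^sup>k Q a\<close> span a dense subspace
  (\<open>perp_powers_imp_zero\<close>). Choose a constant matrix \<open>B\<close> such that \<open>det (Q B)\<close> is nonzero somewhere on
  \<open>V\<close>, and take the columns of \<open>Q B\<close> as generators. Cramer's rule, followed by elimination of \<open>w\<close> between
  \<open>det (Q B)\<close> and \<open>p\<close>, yields a nonzero \<open>r \<in> \<complex>[z]\<close> such that \<open>r Q a\<close> belongs to the generated module for
  every \<open>a\<close> (\<open>clear_into_generators\<close>). Division by \<open>r\<close> shows that the module and the finitely many functions
  \<open>z\<^sup>k Q e\<^sub>b\<close> with \<open>k \<le> deg r\<close> together span a dense subspace, which gives finite codimension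
  (\<open>finite_codim_closure\<close>).

  \<^emph>\<open>Why fewer do not.\<close> If \<open>l < \<alpha>\<close>, then at each point \<open>x\<close> some vector \<open>v \<noteq> 0\<close> is orthogonal to the \<open>l\<close> values
  \<open>f\<^sub>j(x)\<close>, so that the kernel section of \<open>x\<close> and \<open>v\<close> is orthogonal to the module generated by the \<open>f\<^sub>j\<close>.
  Sections at generic points with distinct \<open>z\<close>-coordinates are linearly independent, hence the
  orthogonal complement of the module has infinite dimension.
\<close>

section \<open>Riesz representation, closures and codimension\<close>

context complex_inner_space
begin

lemma H_zero: "0 \<in> H" and H_add: "\<lbrakk>f \<in> H; g \<in> H\<rbrakk> \<Longrightarrow> f + g \<in> H"
  and H_diff: "\<lbrakk>f \<in> H; g \<in> H\<rbrakk> \<Longrightarrow> f - g \<in> H" and H_scale: "f \<in> H \<Longrightarrow> scale c f \<in> H"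
  using subspace_H by (auto intro: subspace_0 subspace_add subspace_diff subspace_scale)

lemma H_sum: "(\<And>i. i \<in> I \<Longrightarrow> f i \<in> H) \<Longrightarrow> (\<Sum>i\<in>I. f i) \<in> H"
  using subspace_H by (rule subspace_sum)

lemma ip_zero_left: "f \<in> H \<Longrightarrow> ip 0 f = 0"
  using ip_scale[of 0 f 0] H_zero by simp

lemma ip_zero_right: "f \<in> H \<Longrightarrow> ip f 0 = 0"
  using ip_scale_right[of 0 f 0] H_zero by simp

lemma ip_diff: "\<lbrakk>f \<in> H; g \<in> H; h \<in> H\<rbrakk> \<Longrightarrow> ip (f - g) h = ip f h - ip g h"
  using ip_add[of "f - g" g h] H_diff by simp

lemma ip_diff_right: "\<lbrakk>f \<in> H; g \<in> H; h \<in> H\<rbrakk> \<Longrightarrow> ip h (f - g) = ip h f - ip h g"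
  using ip_add_right[of "f - g" g h] H_diff by simp

lemma ip_sum: 
  assumes "h \<in> H" "\<And>i. i \<in> I \<Longrightarrow> f i \<in> H"
  shows "ip (\<Sum>i\<in>I. f i) h = (\<Sum>i\<in>I. ip (f i) h)"
  using assms(2)
  by (induction I rule: infinite_finite_induct) (auto simp: ip_zero_left ip_add H_sum assms(1))

lemma ip_sum_right: 
  assumes "h \<in> H" "\<And>i. i \<in> I \<Longrightarrow> f i \<in> H"
  shows "ip h (\<Sum>i\<in>I. f i) = (\<Sum>i\<in>I. ip h (f i))"
  using assms(2)
  by (induction I rule: infinite_finite_induct) (auto simp: ip_zero_right ip_add_right H_sum assms(1))

lemma hnorm_sq: "f \<in> H \<Longrightarrow> (hnorm f)\<^sup>2 = Re (ip f f)"
  by (simp add: hnorm_def ip_nonneg)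

lemma ip_self_eq_0: "f \<in> H \<Longrightarrow> ip f f = 0 \<Longrightarrow> f = 0"
  using ip_pos[of f] by force

lemma hnorm_scale: "f \<in> H \<Longrightarrow> hnorm (scale c f) = cmod c * hnorm f"
proof -
  assume f: "f \<in> H"
  have "ip (scale c f) (scale c f) = c * (cnj c * ip f f)"
    by (simp only: ip_scale[OF f H_scale[OF f]] ip_scale_right[OF f f])
  also have "\<dots> = of_real ((cmod c)\<^sup>2) * ip f f"
    by (simp only: complex_norm_square mult.assoc)
  also have "\<dots> = of_real ((cmod c * hnorm f)\<^sup>2)"
    by (simp only: ip_self[OF f] of_real_mult power_mult_distrib)
  finally have "(hnorm (scale c f))\<^sup>2 = (cmod c * hnorm f)\<^sup>2"
    by (simp only: hnorm_sq[OF H_scale[OF f]] Re_complex_of_real)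
  then show ?thesis
    using f by (simp add: power2_eq_iff_nonneg hnorm_nonneg H_scale)
qed

lemma hnorm_sq_add:
  assumes "f \<in> H" "g \<in> H"
  shows "(hnorm (f + g))\<^sup>2 = (hnorm f)\<^sup>2 + 2 * Re (ip g f) + (hnorm g)\<^sup>2"
  using assms ip_cnj[of f g] by (simp add: hnorm_sq H_add ip_add ip_add_right)

lemma parallelogram:
  assumes "f \<in> H" "g \<in> H"
  shows "(hnorm (f + g))\<^sup>2 + (hnorm (f - g))\<^sup>2 = 2 * (hnorm f)\<^sup>2 + 2 * (hnorm g)\<^sup>2"
  using assms by (simp add: hnorm_sq H_add H_diff ip_add ip_add_right ip_diff ip_diff_right)

definition perp :: "'h set \<Rightarrow> 'h set" where
  "perp D = {g \<in> H. \<forall>d\<in>D. ip d g = 0}"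

lemma closure_of_iff:
  "D \<subseteq> H \<Longrightarrow> f \<in> mtopology closure_of D \<longleftrightarrow> f \<in> H \<and> (\<forall>r>0. \<exists>d\<in>D. hnorm (f - d) < r)"
  unfolding metric_closure_of by (auto simp: hdist_def in_mball subset_iff)

end

lemma quadratic_nonneg_imp_linear_coeff_zero:
  fixes a b :: real
  assumes nonneg: "\<And>t. 0 \<le> 2 * t * a + t\<^sup>2 * b" and "0 \<le> b"
  shows "a = 0"
proof (rule ccontr)
  assume "a \<noteq> 0"
  \<comment> \<open>near the minimiser \<open>- a / b\<close>, but also defined for \<open>b = 0\<close>\<close>
  have "0 \<le> 2 * (- a / (b + 1)) * a + (- a / (b + 1))\<^sup>2 * b" by (rule nonneg)
  also have "\<dots> = - (a\<^sup>2 * (b + 2) / (b + 1)\<^sup>2)"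
    using \<open>0 \<le> b\<close> by (simp add: divide_simps power2_eq_square) (simp add: algebra_simps)
  also have "\<dots> < 0"
    using \<open>0 \<le> b\<close> \<open>a \<noteq> 0\<close> by simp
  finally show False by simp
qed

context complex_hilbert_space
begin

text \<open>
  Riesz representation on a subspace, obtained by minimising \<open>\<parallel>h\<parallel>\<^sup>2 - 2 Re c\<close> over the graph of the
  functional. The functional is given by its graph because in the applications its values are prescribed on
  linear combinations of kernel sections, and the bound already forces them to be independent of the chosen
  combination.
\<close>

lemma bounded_relation_representation:
  assumes R: "R \<subseteq> H \<times> UNIV" "(0, 0) \<in> R"
    and add: "\<And>h c h' c'. (h, c) \<in> R \<Longrightarrow> (h', c') \<in> R \<Longrightarrow> (h + h', c + c') \<in> R"
    and scl: "\<And>h c a. (h, c) \<in> R \<Longrightarrow> (scale a h, a * c) \<in> R"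
    and bd: "\<And>h c. (h, c) \<in> R \<Longrightarrow> cmod c \<le> C * hnorm h" and "0 \<le> C"
  obtains u where "u \<in> mtopology closure_of (fst ` R)" "hnorm u \<le> C"
    "\<And>h c. (h, c) \<in> R \<Longrightarrow> ip h u = c"
proof -
  have RH: "h \<in> H" if "(h, c) \<in> R" for h c using R that by blast
  define E where "E = (\<lambda>(h, c). (hnorm h)\<^sup>2 - 2 * Re c)"
  have E_bd: "- C\<^sup>2 \<le> E r" if "r \<in> R" for r
  proof -
    obtain h c where r: "r = (h, c)" by force
    have "Re c \<le> C * hnorm h"
      using bd[of h c] complex_Re_le_cmod[of c] that r by simp
    moreover have "0 \<le> (hnorm h - C)\<^sup>2" by simp
    ultimately show ?thesis by (simp add: E_def r power2_diff algebra_simps)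
  qed
  define I where "I = Inf (E ` R)"
  have bdd: "bdd_below (E ` R)" using E_bd by (intro bdd_belowI[of _ "- C\<^sup>2"]) auto
  have I_le: "I \<le> E r" if "r \<in> R" for r
    unfolding I_def using that bdd by (intro cInf_lower) auto
  have "\<exists>r\<in>R. E r < I + inverse (real (Suc k))" for k
    using cInf_lessD[of "E ` R" "I + inverse (real (Suc k))"] R(2) by (auto simp: I_def)
  then obtain r where r: "\<And>k. r k \<in> R" "\<And>k. E (r k) < I + inverse (real (Suc k))" by metis
  define s d where "s k = fst (r k)" and "d k = snd (r k)" for k
  have sd: "(s k, d k) \<in> R" "E (s k, d k) < I + inverse (real (Suc k))" for k
    using r by (simp_all add: s_def d_def)
  have sH: "s k \<in> H" for k using RH sd by blast
  \<comment> \<open>the value of \<open>E\<close> at the midpoint is at least \<open>I\<close>, so by the parallelogram law a minimising sequence is Cauchy\<close>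
  have close: "(hnorm (s k - s l))\<^sup>2 \<le> 2 * inverse (real (Suc k)) + 2 * inverse (real (Suc l))" for k l
  proof -
    have "I \<le> E (scale (1/2) (s k + s l), (1/2) * (d k + d l))"
      using sd by (intro I_le scl add)
    also have "\<dots> = (hnorm (s k + s l))\<^sup>2 / 4 - Re (d k) - Re (d l)"
      by (simp add: E_def hnorm_scale H_add sH power_mult_distrib power_divide add_divide_distrib)
    finally show ?thesis
      using sd(2)[of k] sd(2)[of l] parallelogram[OF sH sH, of k l] by (simp add: E_def)
  qed
  have "MCauchy s"
    unfolding MCauchy_def
  proof (intro conjI allI impI)
    fix e :: real assume "0 < e"
    obtain N where N: "inverse (real (Suc N)) < e\<^sup>2 / 4"
      using reals_Archimedean[of "e\<^sup>2 / 4"] \<open>0 < e\<close> by auto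
    have "hdist (s k) (s l) < e" if "N \<le> k" "N \<le> l" for k l
    proof -
      have "inverse (real (Suc k)) \<le> inverse (real (Suc N))"
           "inverse (real (Suc l)) \<le> inverse (real (Suc N))"
        using that by (simp_all add: le_imp_inverse_le)
      then have "(hnorm (s k - s l))\<^sup>2 < e\<^sup>2" using close[of k l] N by linarith
      then show ?thesis
        using \<open>0 < e\<close> by (simp add: hdist_def sH) (meson less_imp_le power2_less_imp_less)
    qed
    then show "\<exists>N. \<forall>n n'. N \<le> n \<longrightarrow> N \<le> n' \<longrightarrow> hdist (s n) (s n') < e" by blast
  qed (use sH in auto)
  then obtain u where u: "limitin mtopology s u sequentially"
    using complete_H unfolding mcomplete_def by blast
  have uH: "u \<in> H" using limitin_mspace[OF u] .
  have lim: "(\<lambda>k. hnorm (s k - u)) \<longlonglongrightarrow> 0"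
    using u by (simp add: limitin_metric_dist_null hdist_def sH uH)
  have ip_lim: "(\<lambda>k. ip g (s k)) \<longlonglongrightarrow> ip g u" if g: "g \<in> H" for g
  proof (rule Lim_transform_bound[where g="\<lambda>k. hnorm g * hnorm (s k - u)", THEN LIM_zero_cancel])
    show "\<forall>\<^sub>F k in sequentially. norm (ip g (s k) - ip g u) \<le> norm (hnorm g * hnorm (s k - u))"
      using g uH sH Cauchy_Schwarz[OF g H_diff[OF sH uH]] 
      by (intro always_eventually) (simp add: ip_diff_right[symmetric] abs_mult hnorm_nonneg H_diff)
    show "(\<lambda>k. hnorm g * hnorm (s k - u)) \<longlonglongrightarrow> 0"
      using tendsto_mult_left[OF lim, of "hnorm g"] by simp
  qed
  \<comment> \<open>first variation of \<open>E\<close> at the limit \<open>u\<close>, in the direction of \<open>(g, b)\<close>; imaginary parts follow from \<open>(\<i> g, \<i> b)\<close>\<close>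
  have Re_eq: "Re (ip g u) = Re b" if gb: "(g, b) \<in> R" for g b
  proof -
    have g: "g \<in> H" using RH gb .
    have *: "0 \<le> 2 * t * (Re (ip g u) - Re b) + t\<^sup>2 * (hnorm g)\<^sup>2" for t
    proof (rule LIMSEQ_le_const)
      show "(\<lambda>k. inverse (real (Suc k)) + (2 * t * (Re (ip g (s k)) - Re b) + t\<^sup>2 * (hnorm g)\<^sup>2))
         \<longlonglongrightarrow> 2 * t * (Re (ip g u) - Re b) + t\<^sup>2 * (hnorm g)\<^sup>2"
        using tendsto_add[OF LIMSEQ_inverse_real_of_nat, 
          of "\<lambda>k. 2 * t * (Re (ip g (s k)) - Re b) + t\<^sup>2 * (hnorm g)\<^sup>2"
              "2 * t * (Re (ip g u) - Re b) + t\<^sup>2 * (hnorm g)\<^sup>2"] ip_lim[OF g]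
        by (simp add: tendsto_intros)
      have "I \<le> E (s k + scale (of_real t) g, d k + of_real t * b)" for k
        using sd gb by (intro I_le scl add)
      then have "0 \<le> inverse (real (Suc k)) + (2 * t * (Re (ip g (s k)) - Re b) + t\<^sup>2 * (hnorm g)\<^sup>2)" for k
        using sd(2)[of k] sH g
        by (simp add: E_def hnorm_sq_add H_scale ip_scale hnorm_scale power_mult_distrib
              algebra_simps add_strict_increasing2) (smt (verit))
      then show "\<exists>N. \<forall>k\<ge>N. 0 \<le> inverse (real (Suc k)) + (2 * t * (Re (ip g (s k)) - Re b) + t\<^sup>2 * (hnorm g)\<^sup>2)"
        by blast
    qed
    have "Re (ip g u) - Re b = 0"
      using * by (rule quadratic_nonneg_imp_linear_coeff_zero) simp
    then show ?thesis by simp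
  qed
  have rep: "ip g u = b" if gb: "(g, b) \<in> R" for g b
    using Re_eq[OF gb] Re_eq[OF scl[OF gb, of \<i>]] RH[OF gb] uH
    by (simp add: ip_scale complex_eq_iff)
  have cl: "u \<in> mtopology closure_of (fst ` R)"
  proof -
    have "\<exists>d\<in>fst ` R. hnorm (u - d) < e" if "0 < e" for e
    proof -
      have "\<forall>\<^sub>F k in sequentially. hnorm (s k - u) < e"
        using order_tendstoD(2)[OF lim that] .
      then obtain k where "hnorm (s k - u) < e" by (auto simp: eventually_sequentially)
      moreover have "hnorm (u - s k) = hnorm (s k - u)"
        using hnorm_minus[OF H_diff[OF sH uH], of k] by simp
      ultimately show ?thesis using sd(1)[of k] by (intro bexI[of _ "s k"]) (auto intro: rev_image_eqI)
    qed
    then show ?thesis using R uH by (subst closure_of_iff) auto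
  qed
  have "hnorm u \<le> C"
  proof -
    have "hnorm u * hnorm u \<le> hnorm u * C"
    proof (rule LIMSEQ_le)
      show "(\<lambda>k. cmod (ip u (s k))) \<longlonglongrightarrow> hnorm u * hnorm u"
        using tendsto_norm[OF ip_lim[OF uH]] ip_self[OF uH] 
        by (simp add: power2_eq_square norm_mult hnorm_nonneg uH abs_mult)
      show "(\<lambda>k. C * (hnorm u + hnorm (s k - u))) \<longlonglongrightarrow> hnorm u * C"
        using tendsto_mult_left[OF tendsto_add[OF tendsto_const lim], of C "hnorm u"] by (simp add: mult.commute)
      have "cmod (ip u (s k)) \<le> C * (hnorm u + hnorm (s k - u))" for k
      proof -
        have "cmod (ip u (s k)) = cmod (d k)"
          using rep[OF sd(1)[of k]] ip_cnj[OF sH uH, of k] by simp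
        also have "\<dots> \<le> C * hnorm (s k)" using bd[OF sd(1)] .
        also have "\<dots> \<le> C * (hnorm u + hnorm (s k - u))"
          using hnorm_triangle[OF uH H_diff[OF sH uH], of k] \<open>0 \<le> C\<close> by (intro mult_left_mono) auto
        finally show ?thesis .
      qed
      then show "\<exists>N. \<forall>k\<ge>N. cmod (ip u (s k)) \<le> C * (hnorm u + hnorm (s k - u))" by blast
    qed
    then show ?thesis using hnorm_nonneg[OF uH] \<open>0 \<le> C\<close>
      by (cases "hnorm u = 0") auto
  qed
  then show ?thesis using that cl rep by blast
qed

lemma closure_perp_eq_0:
  assumes "D \<subseteq> H" "f \<in> mtopology closure_of D" "g \<in> perp D"
  shows "ip f g = 0"
proof (rule ccontr)
  assume ne: "ip f g \<noteq> 0"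
  have g: "g \<in> H" using assms by (simp add: perp_def)
  have f: "f \<in> H" using assms closure_of_iff by blast
  have "0 < cmod (ip f g) / (hnorm g + 1)"
    using ne hnorm_nonneg[OF g] by simp
  then obtain d where d: "d \<in> D" "hnorm (f - d) < cmod (ip f g) / (hnorm g + 1)"
    using assms closure_of_iff by blast
  have dH: "d \<in> H" using d assms by auto
  have "ip f g = ip (f - d) g" using f g dH assms(3) d by (simp add: ip_diff perp_def)
  then have "cmod (ip f g) \<le> hnorm (f - d) * hnorm g"
    using Cauchy_Schwarz[OF H_diff[OF f dH] g] by simp
  also have "\<dots> \<le> hnorm (f - d) * (hnorm g + 1)"
    using hnorm_nonneg[OF H_diff[OF f dH]] by (simp add: algebra_simps)
  also have "\<dots> < cmod (ip f g)"
    using d(2) hnorm_nonneg[OF g] by (simp add: pos_less_divide_eq)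
  finally show False by simp
qed

lemma orthogonal_projection:
  assumes D: "subspace D" "D \<subseteq> H" and f: "f \<in> H"
  obtains u where "u \<in> mtopology closure_of D" "f - u \<in> perp D"
proof -
  let ?R = "{(d, ip d f) | d. d \<in> D}"
  obtain u where u: "u \<in> mtopology closure_of (fst ` ?R)" "\<And>h c. (h, c) \<in> ?R \<Longrightarrow> ip h u = c"
  proof (rule bounded_relation_representation[of ?R "hnorm f"])
    show "(0, 0) \<in> ?R" using D f by (auto simp: ip_zero_left subspace_0)
    show "(h + h', c + c') \<in> ?R" if "(h, c) \<in> ?R" "(h', c') \<in> ?R" for h c h' c'
      using that D f by (auto simp: ip_add subspace_add subset_iff)
    show "(scale a h, a * c) \<in> ?R" if "(h, c) \<in> ?R" for h c a
      using that D f by (auto simp: ip_scale subspace_scale subset_iff)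
    show "cmod c \<le> hnorm f * hnorm h" if "(h, c) \<in> ?R" for h c
      using that D f Cauchy_Schwarz[of h f] by (auto simp: mult.commute)
  qed (use D f hnorm_nonneg in auto)
  have "fst ` ?R = D" by force
  with u have uc: "u \<in> mtopology closure_of D" by simp
  then have uH: "u \<in> H" using closure_of_iff D by blast
  have "f - u \<in> perp D" 
    using u(2) f uH D by (auto simp: perp_def H_diff ip_diff_right subset_iff)
  with uc that show ?thesis by blast
qed

text \<open>
  Membership in a closure thus becomes a linear condition.
\<close>

lemma closure_of_eq_perp_perp:
  assumes D: "subspace D" "D \<subseteq> H"
  shows "mtopology closure_of D = perp (perp D)"
proof (intro equalityI subsetI)
  fix f assume f: "f \<in> mtopology closure_of D"
  then have fH: "f \<in> H" using closure_of_iff D by blast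
  have "ip d f = 0" if "d \<in> perp D" for d
    using closure_perp_eq_0[OF D(2) f that] ip_cnj[OF fH, of d] that by (simp add: perp_def)
  then show "f \<in> perp (perp D)" using fH by (simp add: perp_def)
next
  fix f assume f: "f \<in> perp (perp D)"
  then have fH: "f \<in> H" by (simp add: perp_def)
  obtain u where u: "u \<in> mtopology closure_of D" "f - u \<in> perp D"
    using orthogonal_projection[OF D fH] .
  have uH: "u \<in> H" using closure_of_iff u D by blast
  have "ip (f - u) f = 0" using f u by (simp add: perp_def)
  moreover have "ip u (f - u) = 0" using closure_perp_eq_0[OF D(2) u] .
  then have "ip (f - u) u = 0" using ip_cnj[OF uH H_diff[OF fH uH]] by simp
  ultimately have "ip (f - u) (f - u) = 0" using fH uH by (simp add: ip_diff_right H_diff)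
  then have "f - u = 0" using ip_self_eq_0 H_diff fH uH by blast
  then show "f \<in> mtopology closure_of D" using u by simp
qed

text \<open>
  The vectors of \<open>F\<close> are added to \<open>N\<close> one at a time. Each of them enlarges the closure by at most one
  dimension, and at the end the closure is everything, because nothing but \<open>0\<close> is orthogonal to it.
\<close>

lemma finite_codim_closure:
  assumes "finite F" "F \<subseteq> H" "subspace N" "N \<subseteq> H"
    and "\<And>h. h \<in> perp N \<Longrightarrow> h \<in> perp F \<Longrightarrow> h = 0"
  shows "finite_codim (mtopology closure_of N)"
proof -
  have "\<forall>h\<in>H. \<exists>g\<in>span F. h - g \<in> mtopology closure_of N"
    using assms
  proof (induction F arbitrary: N rule: finite_induct)
    case empty
    have "h \<in> mtopology closure_of N" if hH: "h \<in> H" for h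
    proof -
      obtain u where u: "u \<in> mtopology closure_of N" "h - u \<in> perp N"
        using orthogonal_projection[OF empty(2,3) hH] .
      then have "h - u = 0" using empty.prems(4)[of "h - u"] by (simp add: perp_def)
      then show ?thesis using u by simp
    qed
    then show ?case by auto
  next
    case (insert v F)
    have vH: "v \<in> H" using insert by auto
    define N' where "N' = {n + scale c v | n c. n \<in> N}"
    have N'H: "N' \<subseteq> H" using insert.prems vH by (auto simp: N'_def intro!: H_add H_scale)
    have N': "subspace N'"
      unfolding subspace_def
    proof (intro conjI ballI allI)
      have "0 = 0 + scale 0 v" by simp
      then show "0 \<in> N'" unfolding N'_def using subspace_0[OF insert.prems(2)] by blast
    next
      fix x y assume "x \<in> N'" "y \<in> N'"
      then obtain n c n' c' where "x = n + scale c v" "y = n' + scale c' v" "n \<in> N" "n' \<in> N"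
        by (auto simp: N'_def)
      moreover then have "x + y = (n + n') + scale (c + c') v" by (simp add: scale_left_distrib)
      ultimately show "x + y \<in> N'" unfolding N'_def using subspace_add[OF insert.prems(2)] by blast
    next
      fix a x assume "x \<in> N'"
      then obtain n c where "x = n + scale c v" "n \<in> N" by (auto simp: N'_def)
      moreover then have "scale a x = scale a n + scale (a * c) v" by (simp add: scale_right_distrib)
      ultimately show "scale a x \<in> N'" unfolding N'_def using subspace_scale[OF insert.prems(2)] by blast
    qed
    have perp_N': "h \<in> perp N' \<longleftrightarrow> h \<in> perp N \<and> ip v h = 0" for h
    proof
      assume h: "h \<in> perp N'"
      have "n \<in> N'" if "n \<in> N" for n
        unfolding N'_def using that by (intro CollectI exI[of _ n] exI[of _ 0]) simp
      moreover have "v \<in> N'"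
        unfolding N'_def using subspace_0[OF insert.prems(2)] by (intro CollectI exI[of _ 0] exI[of _ 1]) simp
      ultimately show "h \<in> perp N \<and> ip v h = 0" using h by (auto simp: perp_def)
    next
      assume "h \<in> perp N \<and> ip v h = 0"
      then show "h \<in> perp N'" 
        using insert.prems(3) vH by (auto simp: perp_def N'_def ip_add ip_scale H_scale subset_iff)
    qed
    have IH: "\<forall>h\<in>H. \<exists>g\<in>span F. h - g \<in> mtopology closure_of N'"
      using insert.prems by (intro insert.IH N' N'H) (auto simp: perp_N', auto simp: perp_def)
    obtain u where u: "u \<in> mtopology closure_of N" "v - u \<in> perp N"
      using orthogonal_projection[OF insert.prems(2,3) vH] .
    have uH: "u \<in> H" using closure_of_iff u insert.prems by blast
    have upp: "ip d u = 0" if "d \<in> perp N" for d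
      using u(1) that by (simp add: closure_of_eq_perp_perp[OF insert.prems(2,3)] perp_def)
    \<comment> \<open>the coefficient of \<open>v\<close> in \<open>f\<close> is read off from the component of \<open>v\<close> orthogonal to \<open>N\<close>\<close>
    have "\<exists>c. f - scale c v \<in> mtopology closure_of N" if f: "f \<in> mtopology closure_of N'" for f
    proof -
      have fH: "f \<in> H" using f closure_of_iff N'H by blast
      define v' where "v' = v - u"
      have v': "v' \<in> perp N" "v' \<in> H" using u by (auto simp: v'_def perp_def)
      define c where "c = ip f v' / ip v' v'"
      have c: "ip f v' = c * ip v' v'"
      proof (cases "v' = 0")
        case True then show ?thesis using fH by (simp add: ip_zero_right ip_zero)
      next
        case False
        then have "ip v' v' \<noteq> 0" using ip_pos[of v'] v' by auto
        then show ?thesis by (simp add: c_def)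
      qed
      have "ip d (f - scale c v) = 0" if d: "d \<in> perp N" for d
      proof -
        have dH: "d \<in> H" using d by (simp add: perp_def)
        obtain w a where w: "d = w + scale a v'" "w \<in> perp N" "ip v w = 0"
        proof -
          define a where "a = ip d v' / ip v' v'"
          have a: "ip d v' = a * ip v' v'"
          proof (cases "v' = 0")
            case True then show ?thesis using dH by (simp add: ip_zero_right ip_zero)
          next
            case False
            then have "ip v' v' \<noteq> 0" using ip_pos[of v'] v' by auto
            then show ?thesis by (simp add: a_def)
          qed
          let ?w = "d - scale a v'"
          have wH: "?w \<in> H" using dH v' by (intro H_diff H_scale)
          have wN: "?w \<in> perp N"
            using d v' wH insert.prems(3) by (auto simp: perp_def ip_diff_right ip_scale_right H_scale subset_iff)
          have "ip ?w v' = 0" using a v' dH by (simp add: ip_diff ip_scale H_scale)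
          moreover have "ip ?w u = 0" using upp wN by blast
          moreover have "v = v' + u" by (simp add: v'_def)
          ultimately have "ip ?w v = 0" using wH v' uH by (metis ip_add_right add.right_neutral)
          then have "ip v ?w = 0" using ip_cnj[OF wH vH] by simp
          then show ?thesis using wN that[of ?w a] by simp
        qed
        have wH: "w \<in> H" using w by (simp add: perp_def)
        have "ip w f = 0"
          using f w perp_N' by (simp add: closure_of_eq_perp_perp[OF N' N'H] perp_def)
        moreover have "ip w v = 0" using ip_cnj[OF vH wH] w by simp
        moreover have "ip v' f = cnj c * ip v' v'"
          using c ip_cnj[OF fH v'(2)] ip_cnj[OF v'(2) v'(2)] by (metis complex_cnj_mult)
        moreover have "ip v' v = ip v' v'"
          using upp[OF v'(1)] v' uH vH by (simp add: v'_def ip_diff_right H_diff)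
        ultimately show ?thesis
          using wH v' fH vH by (simp add: w(1) ip_add ip_scale ip_diff_right ip_scale_right H_scale H_add H_diff)
      qed
      then have "f - scale c v \<in> perp (perp N)"
        using fH vH by (auto simp: perp_def H_diff H_scale)
      then show ?thesis by (auto simp: closure_of_eq_perp_perp[OF insert.prems(2,3)])
    qed note key = this
    show ?case
    proof
      fix h assume "h \<in> H"
      then obtain g where g: "g \<in> span F" "h - g \<in> mtopology closure_of N'" using IH by blast
      from key[OF g(2)] obtain c where "h - g - scale c v \<in> mtopology closure_of N" ..
      moreover have "g + scale c v \<in> span (insert v F)"
        using g(1) span_mono[of F "insert v F"] by (intro span_add span_scale) (auto intro: span_base)
      ultimately show "\<exists>g\<in>span (insert v F). h - g \<in> mtopology closure_of N"
        by (metis diff_diff_add)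
    qed
  qed
  then show ?thesis using assms unfolding finite_codim_def by blast
qed

end

section \<open>Multiplication operators on reproducing kernel spaces\<close>

definition cdot :: "complex ^ 'n \<Rightarrow> complex ^ 'n \<Rightarrow> complex" where
  "cdot a b = (\<Sum>i\<in>UNIV. a $ i * cnj (b $ i))"

lemma cdot_add_left: "cdot (a + b) c = cdot a c + cdot b c"
  and cdot_add_right: "cdot c (a + b) = cdot c a + cdot c b"
  and cdot_scale_left: "cdot (r *s a) c = r * cdot a c"
  and cdot_scale_right: "cdot c (r *s a) = cnj r * cdot c a"
  and cdot_zero_left [simp]: "cdot 0 a = 0"
  and cdot_zero_right [simp]: "cdot a 0 = 0"
  by (simp_all add: cdot_def sum.distrib sum_distrib_left algebra_simps)

lemma cdot_commute: "cdot b a = cnj (cdot a b)"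
  by (simp add: cdot_def mult.commute)

lemma cdot_sum_left: "cdot (\<Sum>i\<in>I. f i) c = (\<Sum>i\<in>I. cdot (f i) c)"
  by (induction I rule: infinite_finite_induct) (simp_all add: cdot_add_left)

lemma cdot_sum_right: "cdot c (\<Sum>i\<in>I. f i) = (\<Sum>i\<in>I. cdot c (f i))"
  by (induction I rule: infinite_finite_induct) (simp_all add: cdot_add_right)

lemma cdot_self: "cdot a a = of_real (\<Sum>i\<in>UNIV. (cmod (a $ i))\<^sup>2)"
  by (simp only: cdot_def of_real_sum complex_norm_square)

lemma cdot_self_nonneg: "0 \<le> Re (cdot a a)"
  by (simp only: cdot_self Re_complex_of_real sum_nonneg zero_le_power2)

lemma cdot_self_eq_0_iff: "cdot a a = 0 \<longleftrightarrow> a = 0"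
  by (simp only: cdot_self of_real_eq_0_iff) (simp add: sum_nonneg_eq_0_iff vec_eq_iff)

lemma cdot_axis: "cdot a (axis i 1) = a $ i"
  by (simp add: cdot_def axis_def if_distrib[of cnj] if_distrib[of "\<lambda>x. _ * x"] cong: if_cong)

lemma cdot_eqI: "(\<And>v. cdot a v = cdot b v) \<Longrightarrow> a = b"
  by (metis cdot_axis vec_eq_iff)

lemma cdot_adj: "cdot (A *v a) b = cdot a (adj_mat A *v b)"
proof -
  have "cdot (A *v a) b = (\<Sum>i\<in>UNIV. \<Sum>j\<in>UNIV. A $ i $ j * a $ j * cnj (b $ i))"
    by (simp add: cdot_def matrix_vector_mult_def sum_distrib_right)
  also have "\<dots> = (\<Sum>j\<in>UNIV. \<Sum>i\<in>UNIV. A $ i $ j * a $ j * cnj (b $ i))"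
    by (rule sum.swap)
  also have "\<dots> = cdot a (adj_mat A *v b)"
    by (simp add: cdot_def matrix_vector_mult_def adj_mat_def sum_distrib_left algebra_simps)
  finally show ?thesis .
qed

lemma matrix_vector_scale: "A *v (c *s v) = c *s (A *v (v :: complex ^ 'n))"
  by (simp add: vec_eq_iff matrix_vector_mult_def sum_distrib_left algebra_simps)

lemma one_minus_mult_cnj_nonzero:
  assumes "cmod a < 1" "cmod b < 1"
  shows "1 - a * cnj b \<noteq> 0"
proof
  assume "1 - a * cnj b = 0"
  then have "cmod (a * cnj b) = 1" by simp
  moreover have "cmod a * cmod b < 1 * 1" using assms by (intro mult_strict_mono') auto
  ultimately show False by (simp add: norm_mult)
qed

text \<open>
  Turns each of the two formulas for an admissible kernel into the multiplicative form in which it is used.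
\<close>

lemma clear_kernel_denominator:
  fixes A :: "complex ^ 'b ^ 'a" and B :: "complex ^ 'a ^ 'b"
  assumes "cmod a < 1" "cmod b < 1" and M: "\<And>i j. M $ i $ j = (A ** B) $ i $ j / (1 - a * cnj b)"
  shows "(1 - a * cnj b) *s (M *v v) = A *v (B *v v)"
proof -
  define c where "c = 1 - a * cnj b"
  have c: "c \<noteq> 0" using one_minus_mult_cnj_nonzero assms by (simp add: c_def)
  have "c *s (M *v v) = (A ** B) *v v"
    using c by (simp add: vec_eq_iff matrix_vector_mult_def M c_def[symmetric] sum_distrib_left)
  then show ?thesis by (simp add: c_def[symmetric] matrix_vector_mul_assoc)
qed

text \<open>
  Serves to add two linear combinations of kernel sections that are based at different finite sets of points.
\<close>

lemma sum_Un_additive: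
  fixes \<phi> :: "'x \<Rightarrow> 'v::monoid_add \<Rightarrow> 'w::comm_monoid_add"
  assumes add: "\<And>x a b. \<phi> x (a + b) = \<phi> x a + \<phi> x b" and z: "\<And>x. \<phi> x 0 = 0"
    and fin: "finite Y" "finite Z"
  shows "(\<Sum>x\<in>Y \<union> Z. \<phi> x ((if x \<in> Y then V x else 0) + (if x \<in> Z then W x else 0)))
    = (\<Sum>x\<in>Y. \<phi> x (V x)) + (\<Sum>x\<in>Z. \<phi> x (W x))"
proof -
  have "(\<Sum>x\<in>Y \<union> Z. \<phi> x (if x \<in> Y then V x else 0)) = (\<Sum>x\<in>Y. \<phi> x (V x))"
    using fin by (intro sum.mono_neutral_cong_right) (auto simp: z)
  moreover have "(\<Sum>x\<in>Y \<union> Z. \<phi> x (if x \<in> Z then W x else 0)) = (\<Sum>x\<in>Z. \<phi> x (W x))"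
    using fin by (intro sum.mono_neutral_cong_right) (auto simp: z)
  ultimately show ?thesis by (simp add: add sum.distrib)
qed

definition mul :: "('x \<Rightarrow> complex) \<Rightarrow> ('x \<Rightarrow> complex ^ 'a) \<Rightarrow> 'x \<Rightarrow> complex ^ 'a" where
  "mul g f = (\<lambda>x. g x *s f x)"

lemma mul_add: "mul g (f + h) = mul g f + mul g h"
  by (simp add: mul_def fun_eq_iff vec.scale_right_distrib)

lemma mul_diff: "mul g (f - h) = mul g f - mul g h"
  by (simp add: mul_def fun_eq_iff vec.scale_right_diff_distrib)

lemma mul_fun_scale: "mul g (fun_scale c f) = fun_scale c (mul g f)"
  by (simp add: mul_def fun_scale_def fun_eq_iff mult.commute)

lemma mul_mul: "mul g (mul h f) = mul (\<lambda>x. g x * h x) f"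
  by (simp add: mul_def)

lemma mul_one: "mul (\<lambda>_. 1) f = f"
  by (simp add: mul_def)

lemma fun_sum_apply: "(\<Sum>i\<in>I. f i) x = (\<Sum>i\<in>I. f i x)"
  by (induction I rule: infinite_finite_induct) auto

context rkhs
begin

lemma ip_section: "f \<in> H \<Longrightarrow> y \<in> X \<Longrightarrow> ip f (kernel_section X K y v) = cdot (f y) v"
  by (simp add: reproducing cdot_def)

lemma ip_section_left: "f \<in> H \<Longrightarrow> y \<in> X \<Longrightarrow> ip (kernel_section X K y v) f = cnj (cdot (f y) v)"
  by (metis ip_cnj ip_section kernel_section_in)

lemma section_apply: "x \<in> X \<Longrightarrow> kernel_section X K y v x = K x y *v v"
  by (simp add: kernel_section_def)

lemma section_add: "kernel_section X K y (v + w) = kernel_section X K y v + kernel_section X K y w"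
  by (simp add: kernel_section_def fun_eq_iff vec.add)

lemma section_zero: "kernel_section X K y 0 = 0"
  by (simp add: kernel_section_def fun_eq_iff)

lemma section_scale: "kernel_section X K y (c *s v) = fun_scale c (kernel_section X K y v)"
  by (simp add: kernel_section_def fun_scale_def fun_eq_iff matrix_vector_scale)

lemma eq_on_X_imp_eq: "f \<in> H \<Longrightarrow> g \<in> H \<Longrightarrow> (\<And>x. x \<in> X \<Longrightarrow> f x = g x) \<Longrightarrow> f = g"
  by (rule ext) (metis vanish_outside)

text \<open>
  The bound lets Riesz representation produce an element of the space that pairs with every kernel section as \<open>u\<close>
  should, and pairings with kernel sections are the point values.
\<close>

lemma mem_if_bounded_on_sections:
  assumes u: "\<And>x. x \<notin> X \<Longrightarrow> u x = 0" and "0 \<le> C"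
    and bd: "\<And>Y V. finite Y \<Longrightarrow> Y \<subseteq> X \<Longrightarrow>
      cmod (\<Sum>y\<in>Y. cdot (u y) (V y)) \<le> C * hnorm (\<Sum>y\<in>Y. kernel_section X K y (V y))"
  shows "u \<in> H" "hnorm u \<le> C"
proof -
  let ?R = "{(\<Sum>y\<in>Y. kernel_section X K y (V y), \<Sum>y\<in>Y. cnj (cdot (u y) (V y))) | Y V. finite Y \<and> Y \<subseteq> X}"
  have sH: "(\<Sum>y\<in>Y. kernel_section X K y (V y)) \<in> H" if "Y \<subseteq> X" for Y V
    using that by (intro H_sum kernel_section_in) auto
  obtain g where g: "g \<in> mtopology closure_of (fst ` ?R)" "hnorm g \<le> C"
    "\<And>h c. (h, c) \<in> ?R \<Longrightarrow> ip h g = c"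
  proof (rule bounded_relation_representation[of ?R C])
    show "?R \<subseteq> H \<times> UNIV" using sH by blast
    show "(0, 0) \<in> ?R" by (intro CollectI exI[of _ "{}"]) simp
  next
    fix h c h' c' assume "(h, c) \<in> ?R" "(h', c') \<in> ?R"
    then obtain Y V Z W where *: "finite Y" "Y \<subseteq> X" "finite Z" "Z \<subseteq> X"
      and hc: "h = (\<Sum>y\<in>Y. kernel_section X K y (V y))" "c = (\<Sum>y\<in>Y. cnj (cdot (u y) (V y)))"
        "h' = (\<Sum>y\<in>Z. kernel_section X K y (W y))" "c' = (\<Sum>y\<in>Z. cnj (cdot (u y) (W y)))"
      by blast
    let ?U = "\<lambda>y. (if y \<in> Y then V y else 0) + (if y \<in> Z then W y else 0)"
    have "h + h' = (\<Sum>y\<in>Y \<union> Z. kernel_section X K y (?U y))"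
      unfolding hc by (rule sum_Un_additive[symmetric]) (auto simp: * section_add section_zero)
    moreover have "c + c' = (\<Sum>y\<in>Y \<union> Z. cnj (cdot (u y) (?U y)))"
      unfolding hc by (rule sum_Un_additive[symmetric]) (auto simp: * cdot_add_right)
    ultimately show "(h + h', c + c') \<in> ?R"
      using * by (intro CollectI exI[of _ "Y \<union> Z"] exI[of _ ?U]) auto
  next
    fix h c a assume "(h, c) \<in> ?R"
    then obtain Y V where *: "finite Y" "Y \<subseteq> X" 
      and hc: "h = (\<Sum>y\<in>Y. kernel_section X K y (V y))" "c = (\<Sum>y\<in>Y. cnj (cdot (u y) (V y)))"
      by blast
    show "(fun_scale a h, a * c) \<in> ?R"
      using * by (intro CollectI exI[of _ Y] exI[of _ "\<lambda>y. a *s V y"])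
        (simp add: hc section_scale scale_sum_right cdot_scale_right sum_distrib_left)
  next
    fix h c assume "(h, c) \<in> ?R"
    then obtain Y V where *: "finite Y" "Y \<subseteq> X" 
      and hc: "h = (\<Sum>y\<in>Y. kernel_section X K y (V y))" "c = (\<Sum>y\<in>Y. cnj (cdot (u y) (V y)))"
      by blast
    have "c = cnj (\<Sum>y\<in>Y. cdot (u y) (V y))" by (simp add: hc)
    then have "cmod c = cmod (\<Sum>y\<in>Y. cdot (u y) (V y))" by (simp only: complex_mod_cnj)
    then show "cmod c \<le> C * hnorm h" using bd[OF *] hc by simp
  qed (use \<open>0 \<le> C\<close> in auto)
  have "fst ` ?R \<subseteq> H" using sH by force
  then have gH: "g \<in> H" using g(1) closure_of_iff by blast
  have "g = u"
  proof
    fix x show "g x = u x"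
    proof (cases "x \<in> X")
      case True
      have "cdot (g x) v = cdot (u x) v" for v
      proof -
        have "(kernel_section X K x v, cnj (cdot (u x) v)) \<in> ?R"
          using True by (intro CollectI exI[of _ "{x}"] exI[of _ "\<lambda>_. v"]) simp
        from g(3)[OF this] show ?thesis using ip_section_left[OF gH True, of v] by simp
      qed
      then show ?thesis by (rule cdot_eqI)
    next
      case False
      then show ?thesis using vanish_outside[OF gH] u by simp
    qed
  qed
  then show "u \<in> H" "hnorm u \<le> C" using gH g by auto
qed

lemma norm_section_sum:
  assumes "finite Y" "Y \<subseteq> X"
  shows "ip (\<Sum>y\<in>Y. kernel_section X K y (V y)) (\<Sum>y\<in>Y. kernel_section X K y (V y))
    = (\<Sum>x\<in>Y. \<Sum>y\<in>Y. cdot (K x y *v V y) (V x))"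
proof -
  have kH: "kernel_section X K y (V y) \<in> H" if "y \<in> Y" for y
    using that assms by (intro kernel_section_in) auto
  have "ip (\<Sum>y\<in>Y. kernel_section X K y (V y)) (\<Sum>y\<in>Y. kernel_section X K y (V y))
    = (\<Sum>x\<in>Y. cdot ((\<Sum>y\<in>Y. kernel_section X K y (V y)) x) (V x))"
    using assms kH by (simp add: ip_sum_right H_sum ip_section subset_iff)
  also have "\<dots> = (\<Sum>x\<in>Y. \<Sum>y\<in>Y. cdot (K x y *v V y) (V x))"
    using assms by (intro sum.cong refl) (auto simp: fun_sum_apply section_apply cdot_sum_left)
  finally show ?thesis .
qed

text \<open>
  The adjoint of multiplication by \<open>g\<close> has to send the kernel section at \<open>y\<close> to \<open>g(y)\<^sup>*\<close> times itself. On
  combinations \<open>\<Sum> K(\<cdot>,y) v\<^sub>y\<close> this is a contraction, because the loss in squared norm is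
  \<open>\<parallel>\<Sum> L(y)\<^sup>* v\<^sub>y\<parallel>\<^sup>2\<close> by the factorization.
\<close>

lemma mul_contraction:
  fixes L :: "'x \<Rightarrow> complex ^ 'b ^ 'a"
  assumes K: "\<And>x y v. x \<in> X \<Longrightarrow> y \<in> X \<Longrightarrow>
      (1 - g x * cnj (g y)) *s (K x y *v v) = L x *v (adj_mat (L y) *v v)"
    and f: "f \<in> H"
  shows "mul g f \<in> H" "hnorm (mul g f) \<le> hnorm f"
proof -
  have bd: "cmod (\<Sum>y\<in>Y. cdot (mul g f y) (V y)) \<le> hnorm f * hnorm (\<Sum>y\<in>Y. kernel_section X K y (V y))"
    if Y: "finite Y" "Y \<subseteq> X" for Y V
  proof -
    let ?s = "\<Sum>y\<in>Y. kernel_section X K y (V y)"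
    let ?t = "\<Sum>y\<in>Y. kernel_section X K y (cnj (g y) *s V y)"
    have sH: "?s \<in> H" "?t \<in> H" using Y by (auto intro!: H_sum kernel_section_in)
    have "(\<Sum>y\<in>Y. cdot (mul g f y) (V y)) = ip f ?t"
      using f Y by (simp add: ip_sum_right kernel_section_in ip_section subset_iff mul_def
          cdot_scale_left cdot_scale_right)
    then have 1: "cmod (\<Sum>y\<in>Y. cdot (mul g f y) (V y)) \<le> hnorm f * hnorm ?t"
      using Cauchy_Schwarz[OF f sH(2)] by simp
    have "ip ?s ?s - ip ?t ?t = (\<Sum>x\<in>Y. \<Sum>y\<in>Y. cdot (L x *v (adj_mat (L y) *v V y)) (V x))"
      unfolding norm_section_sum[OF Y] sum_subtractf[symmetric]
    proof (intro sum.cong refl)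
      fix x y assume "x \<in> Y" "y \<in> Y"
      then have "cdot (L x *v (adj_mat (L y) *v V y)) (V x)
          = (1 - g x * cnj (g y)) * cdot (K x y *v V y) (V x)"
        using Y K[of x y "V y"] by (metis cdot_scale_left subsetD)
      then show "cdot (K x y *v V y) (V x) - cdot (K x y *v (cnj (g y) *s V y)) (cnj (g x) *s V x)
          = cdot (L x *v (adj_mat (L y) *v V y)) (V x)"
        by (simp add: matrix_vector_scale cdot_scale_left cdot_scale_right algebra_simps)
    qed
    also have "\<dots> = cdot (\<Sum>y\<in>Y. adj_mat (L y) *v V y) (\<Sum>y\<in>Y. adj_mat (L y) *v V y)"
      by (simp add: cdot_adj cdot_sum_left cdot_sum_right)
    finally have "Re (ip ?s ?s) - Re (ip ?t ?t) \<ge> 0"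
      using cdot_self_nonneg by (metis minus_complex.sel(1))
    then have "(hnorm ?t)\<^sup>2 \<le> (hnorm ?s)\<^sup>2" using sH by (simp add: hnorm_sq)
    then have "hnorm ?t \<le> hnorm ?s" using hnorm_nonneg[OF sH(1)] by (rule power2_le_imp_le)
    then show ?thesis using 1 hnorm_nonneg[OF f] mult_left_mono order_trans by blast
  qed
  have "mul g f x = 0" if "x \<notin> X" for x using that f vanish_outside by (simp add: mul_def)
  from mem_if_bounded_on_sections[OF this hnorm_nonneg[OF f] bd]
  show "mul g f \<in> H" "hnorm (mul g f) \<le> hnorm f" by auto
qed

end

section \<open>Multiplication by one coordinate is isometric\<close>

lemma independent_family_spans:
  fixes b :: "'i \<Rightarrow> complex ^ 'n"
  assumes I: "finite I" "card I = CARD('n)"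
    and ind: "\<And>c i. (\<Sum>i\<in>I. c i *s b i) = 0 \<Longrightarrow> i \<in> I \<Longrightarrow> c i = 0"
  obtains c where "a = (\<Sum>i\<in>I. c i *s b i)"
proof -
  have inj: "inj_on b I"
  proof (rule inj_onI, rule ccontr)
    fix i j assume ij: "i \<in> I" "j \<in> I" "b i = b j" "i \<noteq> j"
    let ?c = "\<lambda>k. if k = i then 1 else if k = j then -1 else (0::complex)"
    have "(\<Sum>k\<in>I. ?c k *s b k) = (\<Sum>k\<in>{i, j}. ?c k *s b k)"
      using ij I by (intro sum.mono_neutral_right) auto
    also have "\<dots> = 0" using ij by simp
    finally show False using ind[of ?c i] ij by simp
  qed
  have "vec.independent (b ` I)"
  proof (rule vec.independent_if_scalars_zero)
    fix f x assume *: "(\<Sum>x\<in>b ` I. f x *s x) = 0" "x \<in> b ` I"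
    then have "(\<Sum>i\<in>I. f (b i) *s b i) = 0" by (simp add: sum.reindex[OF inj])
    then show "f x = 0" using ind[of "\<lambda>i. f (b i)"] * by blast
  qed (use I in auto)
  then have "(UNIV :: (complex ^ 'n) set) \<subseteq> vec.span (b ` I)"
    using I inj by (intro vec.card_ge_dim_independent) (auto simp: card_image card_cart_basis)
  then have "a \<in> range (\<lambda>u. \<Sum>v\<in>b ` I. u v *s v)"
    using I vec.span_finite[of "b ` I"] by auto
  then obtain u where "a = (\<Sum>v\<in>b ` I. u v *s v)" by blast
  then have "a = (\<Sum>i\<in>I. u (b i) *s b i)" by (simp add: sum.reindex[OF inj])
  then show ?thesis by (rule that)
qed

context rkhs
begin

lemma mul_prod_closed:
  assumes t: "\<And>f. f \<in> H \<Longrightarrow> mul t f \<in> H" and "finite I" "f \<in> H"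
  shows "mul (\<lambda>x. \<Prod>i\<in>I. (t x - c i)) f \<in> H"
  using assms(2,3)
proof (induction I)
  case empty
  then show ?case by (simp add: mul_one)
next
  case (insert i I)
  let ?h = "mul (\<lambda>x. \<Prod>i\<in>I. (t x - c i)) f"
  have "mul (\<lambda>x. \<Prod>i\<in>insert i I. (t x - c i)) f = mul t ?h - fun_scale (c i) ?h"
    using insert.hyps by (simp add: mul_def fun_scale_def fun_eq_iff vec.scale_left_diff_distrib left_diff_distrib)
  moreover have "mul t ?h - fun_scale (c i) ?h \<in> H"
    using insert by (intro H_diff H_scale t)
  ultimately show ?case by (simp only:)
qed

text \<open>
  Lagrange interpolation in the values of \<open>t\<close>.
\<close>

lemma isolating_multiplier:
  assumes t: "\<And>f. f \<in> H \<Longrightarrow> mul t f \<in> H" and F: "finite F" "inj_on t F" "x \<in> F" and f: "f \<in> H"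
  obtains h c where "h \<in> H" "c \<noteq> 0" "h x = c *s f x" "\<And>y. y \<in> F \<Longrightarrow> y \<noteq> x \<Longrightarrow> h y = 0"
proof -
  let ?g = "\<lambda>y. \<Prod>z\<in>F - {x}. (t y - t z)"
  have "mul ?g f \<in> H" using mul_prod_closed[OF t] F f by blast
  moreover have "?g x \<noteq> 0" using F by (auto simp: inj_on_def)
  moreover have "?g y = 0" if "y \<in> F" "y \<noteq> x" for y using F that by auto
  ultimately show ?thesis using that[of "mul ?g f" "?g x"] by (simp add: mul_def)
qed

end

lemma zero_if_le_all_multiples:
  fixes M :: real
  assumes "\<And>e. 0 < e \<Longrightarrow> cmod c \<le> e * M"
  shows "c = 0"
proof (rule ccontr)
  assume "c \<noteq> 0"
  have "cmod c \<le> cmod c / (2 * (\<bar>M\<bar> + 1)) * M"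
    using \<open>c \<noteq> 0\<close> by (intro assms) (auto intro!: divide_pos_pos)
  also have "\<dots> \<le> cmod c / (2 * (\<bar>M\<bar> + 1)) * (\<bar>M\<bar> + 1)"
    by (intro mult_left_mono) auto
  also have "\<dots> = cmod c / 2" by (simp add: field_simps)
  finally show False using \<open>c \<noteq> 0\<close> by simp
qed

text \<open>
  Here \<open>g\<close> is the coordinate whose multiplication will be shown to be isometric, and \<open>t\<close> is a second coordinate,
  used to separate the points of a fibre of \<open>g\<close>. The equation between cardinalities says that \<open>L\<close> has just as
  many columns as a full fibre can fill with ranges of \<open>L(x)\<^sup>*\<close>. Such fibres are required over
  arbitrarily small values \<open>\<zeta> \<noteq> 0\<close> because the proof lets \<open>\<zeta>\<close> tend to \<open>0\<close>.
\<close>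

locale coordinate_factorization = rkhs H ip X K
  for H :: "('x \<Rightarrow> complex ^ 'a) set" and ip X K +
  fixes g t :: "'x \<Rightarrow> complex" and L :: "'x \<Rightarrow> complex ^ 'b ^ 'a"
  assumes g_less_1: "x \<in> X \<Longrightarrow> cmod (g x) < 1"
    and factorization: "\<lbrakk>x \<in> X; y \<in> X\<rbrakk> \<Longrightarrow>
      (1 - g x * cnj (g y)) *s (K x y *v v) = L x *v (adj_mat (L y) *v v)"
    and t_closed: "f \<in> H \<Longrightarrow> mul t f \<in> H"
    and small_fibres: "0 < e \<Longrightarrow> \<exists>\<zeta> F. 0 < cmod \<zeta> \<and> cmod \<zeta> < e \<and> finite F \<and> F \<subseteq> X \<and>
      (\<forall>x\<in>F. g x = \<zeta>) \<and> inj_on t F \<and> card F * CARD('a) = CARD('b) \<and>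
      (\<forall>x\<in>F. \<forall>v. adj_mat (L x) *v v = 0 \<longrightarrow> v = 0)"
begin

lemma mul_g_closed: "f \<in> H \<Longrightarrow> mul g f \<in> H" and mul_g_contractive: "f \<in> H \<Longrightarrow> hnorm (mul g f) \<le> hnorm f"
  using mul_contraction[of g L f] factorization by auto

definition Lfun :: "complex ^ 'b \<Rightarrow> 'x \<Rightarrow> complex ^ 'a" where
  "Lfun a = (\<lambda>x. if x \<in> X then L x *v a else 0)"

text \<open>
  The factorization solved for the kernel section: it is the resolvent of multiplication by \<open>g\<close>, applied to
  one of the functions \<open>L a\<close>.
\<close>

lemma section_eq:
  "y \<in> X \<Longrightarrow> kernel_section X K y v = Lfun (adj_mat (L y) *v v) + fun_scale (cnj (g y)) (mul g (kernel_section X K y v))"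
  by (auto simp: fun_eq_iff kernel_section_def Lfun_def fun_scale_def mul_def factorization[symmetric]
      vec.scale_left_diff_distrib mult.commute)

lemma section_self_zero_imp:
  assumes "x \<in> X" "cdot (kernel_section X K x v x) v = 0"
  shows "adj_mat (L x) *v v = 0"
proof -
  have "cdot (adj_mat (L x) *v v) (adj_mat (L x) *v v) = (1 - g x * cnj (g x)) * cdot (K x x *v v) v"
    by (simp only: cdot_adj[symmetric] factorization[OF assms(1,1), symmetric] cdot_scale_left)
  then show ?thesis using assms by (simp add: section_apply cdot_self_eq_0_iff)
qed

text \<open>
  All points of the fibre share the value \<open>\<zeta>\<close> of \<open>g\<close>, so the denominators \<open>1 - g \<zeta>\<^sup>*\<close> of their kernel sections
  agree and a relation between the vectors \<open>L(x)\<^sup>* v\<^sub>x\<close> is a relation between kernel sections. Pairing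
  the latter with functions that vanish at all points of the fibre but one makes each term vanish.
\<close>

lemma fibre_independent:
  assumes F: "finite F" "F \<subseteq> X" "\<forall>x\<in>F. g x = \<zeta>" "inj_on t F"
    and full: "\<forall>x\<in>F. \<forall>v. adj_mat (L x) *v v = 0 \<longrightarrow> v = 0"
    and sum0: "(\<Sum>x\<in>F. adj_mat (L x) *v V x) = 0" and x: "x \<in> F"
  shows "V x = 0"
proof -
  let ?s = "\<Sum>x\<in>F. kernel_section X K x (V x)"
  have kH: "kernel_section X K y (V y) \<in> H" if "y \<in> F" for y
    using F that by (intro kernel_section_in) auto
  have "?s = 0"
  proof (rule eq_on_X_imp_eq)
    fix y assume y: "y \<in> X"
    have \<zeta>: "cmod \<zeta> < 1" using F(2,3) x g_less_1[of x] by auto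
    have "(1 - g y * cnj \<zeta>) *s ?s y = L y *v (\<Sum>x\<in>F. adj_mat (L x) *v V x)"
    proof -
      have "(1 - g y * cnj \<zeta>) *s ?s y = (\<Sum>x\<in>F. (1 - g y * cnj (g x)) *s (K y x *v V x))"
        using F y by (simp only: fun_sum_apply section_apply vec.scale_sum_right) (intro sum.cong, auto)
      also have "\<dots> = (\<Sum>x\<in>F. L y *v (adj_mat (L x) *v V x))"
        using F y by (intro sum.cong factorization) auto
      finally show ?thesis by (simp only: vec.sum)
    qed
    then have "(1 - g y * cnj \<zeta>) *s ?s y = 0" by (simp add: sum0)
    then show "?s y = 0 y" using one_minus_mult_cnj_nonzero[OF g_less_1[OF y] \<zeta>] by (simp only: vec.scale_eq_0_iff zero_fun_def) simp
  next
    show "?s \<in> H" using kH by (rule H_sum)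
  qed (rule H_zero)
  obtain h c where h: "h \<in> H" "c \<noteq> 0" "h x = c *s kernel_section X K x (V x) x" 
    "\<And>y. y \<in> F \<Longrightarrow> y \<noteq> x \<Longrightarrow> h y = 0"
    using isolating_multiplier[OF t_closed F(1,4) x kH[OF x]] by blast
  have "0 = ip h ?s" using \<open>?s = 0\<close> ip_zero_right h by simp
  also have "\<dots> = (\<Sum>y\<in>F. cdot (h y) (V y))"
    using h kH F by (simp add: ip_sum_right ip_section subset_iff)
  also have "\<dots> = (\<Sum>y\<in>{x}. cdot (h y) (V y))"
    using F x h by (intro sum.mono_neutral_right) auto
  also have "\<dots> = c * cdot (kernel_section X K x (V x) x) (V x)" by (simp add: h cdot_scale_left)
  finally have "adj_mat (L x) *v V x = 0" using h(2) F x by (intro section_self_zero_imp) auto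
  then show ?thesis using full x by blast
qed

text \<open>
  By the previous lemma, the vectors \<open>L(x)\<^sup>* e\<^sub>i\<close> are independent, and there are as many of them as the
  dimension.
\<close>

lemma fibre_spans:
  assumes F: "finite F" "F \<subseteq> X" "\<forall>x\<in>F. g x = \<zeta>" "inj_on t F"
    and full: "\<forall>x\<in>F. \<forall>v. adj_mat (L x) *v v = 0 \<longrightarrow> v = 0"
    and card: "card F * CARD('a) = CARD('b)"
  obtains V where "a = (\<Sum>x\<in>F. adj_mat (L x) *v V x)"
proof -
  let ?b = "\<lambda>(x, i). adj_mat (L x) *v axis i 1"
  have *: "(\<Sum>(x, i)\<in>F \<times> UNIV. c (x, i) *s (adj_mat (L x) *v axis i 1))
      = (\<Sum>x\<in>F. adj_mat (L x) *v (\<chi> i. c (x, i)))" for c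
  proof -
    have "adj_mat (L x) *v (\<chi> i. c (x, i)) = (\<Sum>i\<in>UNIV. c (x, i) *s (adj_mat (L x) *v axis i 1))" for x
      using basis_expansion[of "\<chi> i. c (x, i)"]
      by (simp flip: matrix_vector_scale vec.sum)
    then show ?thesis by (simp add: sum.cartesian_product)
  qed
  obtain c where "a = (\<Sum>i\<in>F \<times> UNIV. c i *s ?b i)"
  proof (rule independent_family_spans[of "F \<times> UNIV" ?b a])
    fix c i assume "(\<Sum>i\<in>F \<times> UNIV. c i *s ?b i) = 0" and i: "i \<in> F \<times> (UNIV :: 'a set)"
    then have "(\<Sum>x\<in>F. adj_mat (L x) *v (\<chi> i. c (x, i))) = 0"
      by (simp add: *[symmetric] case_prod_beta')
    from fibre_independent[OF F full this] i show "c i = 0" by (auto simp: vec_eq_iff)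
  qed (use F card in \<open>auto simp: card_cartesian_product\<close>)
  then have "a = (\<Sum>x\<in>F. adj_mat (L x) *v (\<chi> i. c (x, i)))"
    by (simp add: *[symmetric] case_prod_beta')
  then show ?thesis by (rule that)
qed

text \<open>
  The function \<open>G\<close> is \<open>L a / (1 - \<zeta>\<^sup>* g)\<close>. It is a combination of kernel sections over one fibre,
  hence an eigenvector of the adjoint of multiplication by \<open>g\<close>, and it tends to \<open>L a\<close> as \<open>\<zeta>\<close> tends to \<open>0\<close>. The norm
  bound, uniform in \<open>\<zeta>\<close>, comes from \<open>G = L a + \<zeta>\<^sup>* g G\<close> with \<open>|\<zeta>| < 1/2\<close>.
\<close>

lemma Lfun_approx_eigenvector:
  assumes "0 < e"
  obtains G \<zeta> where "G \<in> H" "0 < cmod \<zeta>" "cmod \<zeta> < e"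
    "Lfun a = G - fun_scale (cnj \<zeta>) (mul g G)" "\<And>f. f \<in> H \<Longrightarrow> ip (mul g f) G = \<zeta> * ip f G"
    "Lfun a \<in> H" "hnorm G \<le> 2 * hnorm (Lfun a)"
proof -
  have "0 < min e (1/2)" using assms by simp
  from small_fibres[OF this]
  obtain \<zeta> F where F: "0 < cmod \<zeta>" "cmod \<zeta> < min e (1/2)" "finite F" "F \<subseteq> X" "\<forall>x\<in>F. g x = \<zeta>"
    and F2: "inj_on t F" "card F * CARD('a) = CARD('b)" "\<forall>x\<in>F. \<forall>v. adj_mat (L x) *v v = 0 \<longrightarrow> v = 0"
    by blast
  obtain V where V: "a = (\<Sum>x\<in>F. adj_mat (L x) *v V x)"
    using fibre_spans[OF F(3-5) F2(1,3,2)] by blast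
  define G where "G = (\<Sum>x\<in>F. kernel_section X K x (V x))"
  have kH: "kernel_section X K x (V x) \<in> H" if "x \<in> F" for x using F that by (auto intro: kernel_section_in)
  have G: "G \<in> H" unfolding G_def by (intro H_sum kH)
  have "Lfun a = (\<Sum>x\<in>F. Lfun (adj_mat (L x) *v V x))"
    by (auto simp: V Lfun_def fun_eq_iff fun_sum_apply vec.sum)
  also have "\<dots> = (\<Sum>x\<in>F. kernel_section X K x (V x) - fun_scale (cnj \<zeta>) (mul g (kernel_section X K x (V x))))"
    using F section_eq by (intro sum.cong refl) (metis add_diff_cancel_right' subsetD)
  also have "\<dots> = G - fun_scale (cnj \<zeta>) (mul g G)"
    by (simp add: G_def sum_subtractf fun_eq_iff fun_sum_apply mul_def fun_scale_def vec.scale_sum_right)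
  finally have dec: "Lfun a = G - fun_scale (cnj \<zeta>) (mul g G)" .
  have fnH: "Lfun a \<in> H" unfolding dec by (intro H_diff H_scale mul_g_closed G)
  have eig: "ip (mul g f) G = \<zeta> * ip f G" if f: "f \<in> H" for f
  proof -
    have "ip (mul g f) G = (\<Sum>x\<in>F. cdot (mul g f x) (V x))"
      using kH F by (simp add: G_def ip_sum_right mul_g_closed[OF f] ip_section subset_iff)
    also have "\<dots> = \<zeta> * (\<Sum>x\<in>F. cdot (f x) (V x))"
      using F by (simp add: mul_def cdot_scale_left sum_distrib_left)
    also have "(\<Sum>x\<in>F. cdot (f x) (V x)) = ip f G"
      using kH F by (simp add: G_def ip_sum_right f ip_section subset_iff)
    finally show ?thesis .
  qed
  have "hnorm G \<le> hnorm (Lfun a) + hnorm (fun_scale (cnj \<zeta>) (mul g G))"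
    using hnorm_triangle[OF fnH, of "fun_scale (cnj \<zeta>) (mul g G)"] G
    by (simp add: dec H_scale mul_g_closed)
  also have "\<dots> = hnorm (Lfun a) + cmod \<zeta> * hnorm (mul g G)"
    using G by (simp add: hnorm_scale mul_g_closed)
  also have "\<dots> \<le> hnorm (Lfun a) + 1/2 * hnorm G"
    using G F by (intro add_left_mono mult_mono mul_g_contractive hnorm_nonneg mul_g_closed) auto
  finally have "hnorm G \<le> 2 * hnorm (Lfun a)" by simp
  then show ?thesis using that[OF G F(1) _ dec eig fnH] F by simp
qed

lemma Lfun_in: "Lfun a \<in> H"
  by (rule Lfun_approx_eigenvector[OF zero_less_one, where a = a]; assumption)

text \<open>
  With \<open>G\<close> as above, \<open>\<langle>g f, L a\<rangle> = \<zeta> (\<langle>f, G\<rangle> - \<langle>g f, g G\<rangle>)\<close>, which tends to \<open>0\<close> with \<open>\<zeta>\<close>.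
\<close>

lemma Lfun_orthogonal:
  assumes f: "f \<in> H"
  shows "ip (mul g f) (Lfun a) = 0"
proof (rule zero_if_le_all_multiples)
  fix e :: real assume "0 < e"
  then obtain G \<zeta> where G: "G \<in> H" "0 < cmod \<zeta>" "cmod \<zeta> < e"
    "Lfun a = G - fun_scale (cnj \<zeta>) (mul g G)" "\<And>f. f \<in> H \<Longrightarrow> ip (mul g f) G = \<zeta> * ip f G"
    "Lfun a \<in> H" "hnorm G \<le> 2 * hnorm (Lfun a)"
    by (rule Lfun_approx_eigenvector[where a = a]) (rule that, assumption+)
  have gf: "mul g f \<in> H" and gG: "mul g G \<in> H" using f G(1) by (simp_all add: mul_g_closed)
  have "ip (mul g f) (Lfun a) = \<zeta> * (ip f G - ip (mul g f) (mul g G))"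
    unfolding G(4) using f G(1) G(5)[OF f] gf gG by (simp add: ip_diff_right ip_scale_right H_scale algebra_simps)
  then have "cmod (ip (mul g f) (Lfun a)) = cmod \<zeta> * cmod (ip f G - ip (mul g f) (mul g G))"
    by (simp add: norm_mult)
  also have "\<dots> \<le> cmod \<zeta> * (cmod (ip f G) + cmod (ip (mul g f) (mul g G)))"
    by (intro mult_left_mono norm_triangle_ineq4) auto
  also have "\<dots> \<le> e * (hnorm f * hnorm G + hnorm f * hnorm G)"
    using \<open>0 < e\<close> G(1-3) f gf gG Cauchy_Schwarz[OF f G(1)] order_trans[OF Cauchy_Schwarz[OF gf gG] 
        mult_mono[OF mul_g_contractive[OF f] mul_g_contractive[OF G(1)]]]
    by (intro mult_mono add_mono) (auto simp: hnorm_nonneg less_imp_le[OF \<open>0 < e\<close>])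
  also have "\<dots> \<le> e * (hnorm f * (2 * hnorm (Lfun a)) + hnorm f * (2 * hnorm (Lfun a)))"
    using G(1,6,7) f \<open>0 < e\<close> by (intro mult_left_mono add_mono) (auto simp: hnorm_nonneg)
  finally show "cmod (ip (mul g f) (Lfun a)) \<le> e * (4 * hnorm f * hnorm (Lfun a))"
    by (simp add: algebra_simps)
qed

text \<open>
  The defect \<open>\<langle>g f, g h\<rangle> - \<langle>f, h\<rangle>\<close> vanishes for \<open>h = G\<close>, as orthogonality of \<open>L a\<close> to \<open>g f\<close> shows.
  Therefore its value at \<open>L a\<close> is \<open>-\<zeta>\<close> times its value at \<open>g G\<close>, which tends to \<open>0\<close>.
\<close>

lemma isometric_on_Lfun:
  assumes f: "f \<in> H"
  shows "ip (mul g f) (mul g (Lfun a)) = ip f (Lfun a)"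
proof -
  have "ip (mul g f) (mul g (Lfun a)) - ip f (Lfun a) = 0"
  proof (rule zero_if_le_all_multiples)
    fix e :: real assume "0 < e"
    then obtain G \<zeta> where G: "G \<in> H" "0 < cmod \<zeta>" "cmod \<zeta> < e"
      "Lfun a = G - fun_scale (cnj \<zeta>) (mul g G)" "\<And>f. f \<in> H \<Longrightarrow> ip (mul g f) G = \<zeta> * ip f G"
      "Lfun a \<in> H" "hnorm G \<le> 2 * hnorm (Lfun a)"
      by (rule Lfun_approx_eigenvector[where a = a]) (rule that, assumption+)
    have gf: "mul g f \<in> H" and gG: "mul g G \<in> H" and ggG: "mul g (mul g G) \<in> H"
      using f G(1) by (simp_all add: mul_g_closed)
    have "ip (mul g f) (Lfun a) = 0" by (rule Lfun_orthogonal[OF f])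
    then have "\<zeta> * (ip f G - ip (mul g f) (mul g G)) = 0"
      unfolding G(4) using f G(1) G(5)[OF f] gf gG by (simp add: ip_diff_right ip_scale_right H_scale algebra_simps)
    then have eq: "ip (mul g f) (mul g G) = ip f G" using G by auto
    have "ip (mul g f) (mul g (Lfun a)) - ip f (Lfun a)
        = \<zeta> * (ip f (mul g G) - ip (mul g f) (mul g (mul g G)))"
      unfolding G(4) using f G(1) G(5)[OF f] G(5)[OF gf] gf gG ggG eq
      by (simp add: mul_diff mul_fun_scale ip_diff_right ip_scale_right H_scale algebra_simps)
    then have "cmod (ip (mul g f) (mul g (Lfun a)) - ip f (Lfun a))
        = cmod \<zeta> * cmod (ip f (mul g G) - ip (mul g f) (mul g (mul g G)))"
      by (simp add: norm_mult)
    also have "\<dots> \<le> cmod \<zeta> * (cmod (ip f (mul g G)) + cmod (ip (mul g f) (mul g (mul g G))))"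
      by (intro mult_left_mono norm_triangle_ineq4) auto
    also have "\<dots> \<le> e * (hnorm f * hnorm (mul g G) + hnorm f * hnorm (mul g G))"
      using \<open>0 < e\<close> G(1-3) f gf gG Cauchy_Schwarz[OF f gG] order_trans[OF Cauchy_Schwarz[OF gf ggG] 
          mult_mono[OF mul_g_contractive[OF f] mul_g_contractive[OF gG]]]
      by (intro mult_mono add_mono) (auto simp: hnorm_nonneg ggG less_imp_le[OF \<open>0 < e\<close>])
    also have "\<dots> \<le> e * (hnorm f * (2 * hnorm (Lfun a)) + hnorm f * (2 * hnorm (Lfun a)))"
      using G(1,6,7) f \<open>0 < e\<close> order_trans[OF mul_g_contractive[OF G(1)] G(7)]
      by (intro mult_left_mono add_mono) (auto simp: hnorm_nonneg)
    finally show "cmod (ip (mul g f) (mul g (Lfun a)) - ip f (Lfun a)) \<le> e * (4 * hnorm f * hnorm (Lfun a))"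
      by (simp only: algebra_simps)
  qed
  then show ?thesis by simp
qed

text \<open>
  Where \<open>g(x) \<noteq> 0\<close>, the eigenvector equation for the kernel section can be divided by \<open>g(x)\<close>. Where
  \<open>g(x) = 0\<close>, the kernel section is one of the functions \<open>L a\<close>.
\<close>

lemma isometric_on_sections:
  assumes f: "f \<in> H" and x: "x \<in> X"
  shows "ip (mul g f) (mul g (kernel_section X K x v)) = ip f (kernel_section X K x v)"
proof (cases "g x = 0")
  case True
  then have "kernel_section X K x v = Lfun (adj_mat (L x) *v v)"
    using section_eq[OF x, of v] by (simp add: fun_scale_def fun_eq_iff)
  then show ?thesis using isometric_on_Lfun[OF f] by simp
next
  case False
  let ?k = "kernel_section X K x v"
  have k: "?k \<in> H" "mul g ?k \<in> H" "mul g f \<in> H" using x f by (auto simp: kernel_section_in mul_g_closed)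
  have "g x * ip f ?k = ip (mul g f) ?k"
    using f x k by (simp add: ip_section mul_def cdot_scale_left)
  also have "\<dots> = ip (mul g f) (Lfun (adj_mat (L x) *v v) + fun_scale (cnj (g x)) (mul g ?k))"
    using section_eq[OF x, of v] by simp
  also have "\<dots> = g x * ip (mul g f) (mul g ?k)"
    using k Lfun_in Lfun_orthogonal[OF f] by (simp add: ip_add_right H_scale ip_scale_right)
  finally show ?thesis using False by simp
qed

text \<open>
  The functional \<open>h \<mapsto> \<langle>g h, g f\<rangle>\<close> is represented by some element of the space, which is \<open>f\<close> because both have
  the same pairings with kernel sections.
\<close>

lemma mul_g_isometric:
  assumes f: "f \<in> H"
  shows "hnorm (mul g f) = hnorm f"
proof -
  have gf: "mul g f \<in> H" using f mul_g_closed by blast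
  let ?R = "{(h, ip (mul g h) (mul g f)) | h. h \<in> H}"
  obtain u where u: "u \<in> mtopology closure_of (fst ` ?R)"
    "\<And>h c. (h, c) \<in> ?R \<Longrightarrow> ip h u = c"
  proof (rule bounded_relation_representation[of ?R "hnorm (mul g f)"])
    have "mul g 0 = (0 :: 'x \<Rightarrow> complex ^ 'a)" by (simp add: mul_def fun_eq_iff)
    then show "(0, 0) \<in> ?R" using H_zero gf ip_zero_left by (intro CollectI exI[of _ 0]) simp
    show "(h + h', c + c') \<in> ?R" if "(h, c) \<in> ?R" "(h', c') \<in> ?R" for h c h' c'
      using that gf by (auto simp: mul_add ip_add mul_g_closed H_add)
    show "(fun_scale a h, a * c) \<in> ?R" if "(h, c) \<in> ?R" for h c a
      using that gf by (auto simp: mul_fun_scale ip_scale mul_g_closed H_scale)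
    show "cmod c \<le> hnorm (mul g f) * hnorm h" if "(h, c) \<in> ?R" for h c
    proof -
      have h: "h \<in> H" "c = ip (mul g h) (mul g f)" using that by auto
      have "cmod c \<le> hnorm (mul g h) * hnorm (mul g f)"
        using h gf by (auto intro: Cauchy_Schwarz mul_g_closed)
      also have "\<dots> \<le> hnorm h * hnorm (mul g f)"
        using h gf by (intro mult_right_mono mul_g_contractive hnorm_nonneg)
      finally show ?thesis by (simp add: mult.commute)
    qed
  qed (use gf hnorm_nonneg in auto)
  have "fst ` ?R = H" by force
  then have uH: "u \<in> H" using u(1) closure_of_iff[of H] by simp
  have "u = f"
  proof (rule eq_on_X_imp_eq[OF uH f])
    fix x assume x: "x \<in> X"
    have "cdot (u x) v = cdot (f x) v" for v
    proof -
      let ?k = "kernel_section X K x v"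
      have k: "?k \<in> H" "mul g ?k \<in> H" using x by (auto simp: kernel_section_in mul_g_closed)
      have "ip ?k u = ip (mul g ?k) (mul g f)" using u(2) k by blast
      then have "ip u ?k = ip (mul g f) (mul g ?k)"
        using ip_cnj k uH gf by metis
      also have "\<dots> = ip f ?k" by (rule isometric_on_sections[OF f x])
      finally show ?thesis using x uH f by (simp add: ip_section)
    qed
    then show "u x = f x" by (rule cdot_eqI)
  qed
  then have "ip f f = ip (mul g f) (mul g f)" using u(2) f by blast
  then show ?thesis by (simp add: hnorm_def)
qed

text \<open>
  Iterating \<open>section_eq\<close> expands each kernel section into a geometric series in the functions \<open>g\<^sup>k L a\<close>; its
  remainder is of order \<open>|g(x)|\<^sup>k\<close>.
\<close>

lemma perp_powers_imp_zero:
  assumes h: "h \<in> H" and perp: "\<And>k a. ip h (mul (\<lambda>x. g x ^ k) (Lfun a)) = 0"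
  shows "h = 0"
proof (rule eq_on_X_imp_eq[OF h H_zero])
  fix x assume x: "x \<in> X"
  have "cdot (h x) v = cdot 0 v" for v
  proof -
    let ?k = "kernel_section X K x v"
    have k: "?k \<in> H" using x by (simp add: kernel_section_in)
    have pw: "mul (\<lambda>x. g x ^ j) f \<in> H \<and> hnorm (mul (\<lambda>x. g x ^ j) f) \<le> hnorm f" if "f \<in> H" for j f
    proof (induction j)
      case 0 then show ?case using that by (simp add: mul_one)
    next
      case (Suc j)
      have "mul (\<lambda>x. g x ^ Suc j) f = mul g (mul (\<lambda>x. g x ^ j) f)" by (simp add: mul_mul)
      then show ?case
        using Suc mul_g_closed[of "mul (\<lambda>x. g x ^ j) f"] mul_g_contractive[of "mul (\<lambda>x. g x ^ j) f"] by auto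
    qed
    have iter: "ip h ?k = g x ^ j * ip h (mul (\<lambda>x. g x ^ j) ?k)" for j
    proof (induction j)
      case 0 then show ?case by (simp add: mul_one)
    next
      case (Suc j)
      have "mul (\<lambda>x. g x ^ j) ?k = mul (\<lambda>x. g x ^ j) (Lfun (adj_mat (L x) *v v))
          + fun_scale (cnj (g x)) (mul (\<lambda>x. g x ^ Suc j) ?k)"
        by (subst section_eq[OF x]) (simp add: mul_add mul_fun_scale mul_mul mult.commute)
      then have "ip h (mul (\<lambda>x. g x ^ j) ?k) = g x * ip h (mul (\<lambda>x. g x ^ Suc j) ?k)"
        using h pw[OF Lfun_in] pw[OF k, of "Suc j"] perp
        by (simp only: ip_add_right H_scale ip_scale_right) simp
      then show ?case using Suc by simp
    qed
    have "cmod (ip h ?k) \<le> cmod (g x) ^ j * (hnorm h * hnorm ?k)" for j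
    proof -
      have "cmod (ip h (mul (\<lambda>x. g x ^ j) ?k)) \<le> hnorm h * hnorm (mul (\<lambda>x. g x ^ j) ?k)"
        using h pw[OF k] by (intro Cauchy_Schwarz) auto
      also have "\<dots> \<le> hnorm h * hnorm ?k" using pw[OF k] h by (intro mult_left_mono) (auto simp: hnorm_nonneg)
      finally have "cmod (g x) ^ j * cmod (ip h (mul (\<lambda>x. g x ^ j) ?k)) \<le> cmod (g x) ^ j * (hnorm h * hnorm ?k)"
        by (intro mult_left_mono) auto
      then show ?thesis by (subst iter[of j]) (simp only: norm_mult norm_power)
    qed
    moreover have "(\<lambda>j. cmod (g x) ^ j * (hnorm h * hnorm ?k)) \<longlonglongrightarrow> 0 * (hnorm h * hnorm ?k)"
      using g_less_1[OF x] by (intro tendsto_mult_right LIMSEQ_realpow_zero) auto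
    ultimately have "cmod (ip h ?k) \<le> 0"
      by (intro LIMSEQ_le_const[where X="\<lambda>j. cmod (g x) ^ j * (hnorm h * hnorm ?k)"]) auto
    then show ?thesis using h x by (simp add: ip_section)
  qed
  then show "h x = 0 x" by (simp add: cdot_eqI)
qed

end

section \<open>Evaluation of bivariate polynomials\<close>

lemma eval2_add: "eval2 (p + q) x = eval2 p x + eval2 q x"
  and eval2_diff: "eval2 (p - q) x = eval2 p x - eval2 q x"
  and eval2_mult: "eval2 (p * q) x = eval2 p x * eval2 q x"
  and eval2_zero: "eval2 0 x = 0"
  and eval2_one: "eval2 1 x = 1"
  and eval2_poly_z: "eval2 [:s:] x = poly s (fst x)"
  and eval2_smult: "eval2 (smult s p) x = poly s (fst x) * eval2 p x"
  by (simp_all add: eval2_def)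

lemma eval2_sum: "eval2 (\<Sum>i\<in>I. f i) x = (\<Sum>i\<in>I. eval2 (f i) x)"
  by (induction I rule: infinite_finite_induct) (simp_all add: eval2_add eval2_zero)

lemma eval2_prod: "eval2 (\<Prod>i\<in>I. f i) x = (\<Prod>i\<in>I. eval2 (f i) x)"
  by (induction I rule: infinite_finite_induct) (simp_all add: eval2_mult eval2_one)

lemma eval2_of_int: "eval2 (of_int k) x = of_int k"
proof -
  have "eval2 (of_nat j) x = of_nat j" for j
    by (induction j) (simp_all add: eval2_add eval2_zero eval2_one)
  then show ?thesis by (cases k rule: int_diff_cases) (simp add: eval2_diff)
qed

lemma eval2_det: "eval2 (det A) x = det (eval_mat A x)"
  by (simp add: det_def eval2_sum eval2_mult eval2_of_int eval2_prod eval_mat_def)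

lemma eval2_eq_poly_slice: "eval2 p x = poly (map_poly (\<lambda>c. poly c (fst x)) p) (snd x)"
proof (induction p)
  case 0
  then show ?case by (simp add: eval2_zero)
next
  case (pCons a p)
  have "eval2 (pCons a p) x = poly a (fst x) + snd x * eval2 p x" by (simp add: eval2_def)
  then show ?case using pCons by (simp add: map_poly_pCons)
qed

section \<open>Elimination of one variable\<close>

text \<open>
  Let \<open>g\<close> be a nonzero member of least degree of the ideal generated by \<open>d\<close> and \<open>p\<close>. By pseudo-division it divides
  \<open>p\<close> and \<open>d\<close> up to factors from the coefficient ring. If \<open>g\<close> had positive degree, then the prime \<open>p\<close> would divide
  \<open>g\<close> and hence \<open>d\<close>.
\<close>

lemma eliminate_outer_variable:
  fixes p d :: "'a::field_gcd poly poly"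
  assumes p: "irreducible p" "0 < degree p" and "\<not> p dvd d"
  obtains A B r where "r \<noteq> 0" "A * d + B * p = [:r:]"
proof -
  let ?I = "{A * d + B * p | A B. True}"
  have prime: "prime_elem p" using p(1) by (rule irreducible_imp_prime_elem)
  have "0 * d + 1 * p \<in> ?I" by blast
  then have "p \<in> ?I - {0}" using p by auto
  then obtain g where g: "g \<in> ?I" "g \<noteq> 0" and min: "\<And>h. h \<in> ?I - {0} \<Longrightarrow> degree g \<le> degree h"
    using ex_has_least_nat[of "\<lambda>h. h \<in> ?I - {0}" p degree] by blast
  have div: "\<exists>c q. c \<noteq> 0 \<and> [:c:] * f = g * q" if f: "f \<in> ?I" for f
  proof -
    obtain q r where qr: "pseudo_divmod f g = (q, r)" by force
    define c where "c = coeff g (degree g) ^ (Suc (degree f) - degree g)"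
    have *: "smult c f = g * q + r" "r = 0 \<or> degree r < degree g"
      using pseudo_divmod[OF g(2) qr] by (simp_all add: c_def)
    obtain A B A' B' where AB: "f = A * d + B * p" "g = A' * d + B' * p" using f g by blast
    have "r = smult c f - g * q" using * by simp
    also have "\<dots> = (smult c A - A' * q) * d + (smult c B - B' * q) * p"
      by (simp add: AB algebra_simps smult_add_right)
    finally have "r \<in> ?I" by blast
    then have "degree g \<le> degree r" if "r \<noteq> 0" using min[of r] that by blast
    then have "r = 0" using *(2) by linarith
    then show ?thesis using * g(2) by (intro exI[of _ c] exI[of _ q]) (simp add: c_def)
  qed
  have "degree g = 0"
  proof (rule ccontr)
    assume deg: "degree g \<noteq> 0"
    obtain c q where c: "c \<noteq> 0" "[:c:] * p = g * q" using div[of p] \<open>0 * d + 1 * p \<in> ?I\<close> by auto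
    then have "p dvd g * q" by (metis dvd_triv_right)
    then have "p dvd g \<or> p dvd q" using prime by (simp add: prime_elem_dvd_mult_iff)
    moreover have "\<not> p dvd q"
    proof
      assume "p dvd q"
      then obtain q' where "q = p * q'" by blast
      then have "p * [:c:] = p * (g * q')" using c by (simp only: ac_simps)
      then have eq: "[:c:] = g * q'" using p by (subst (asm) mult_cancel_left) auto
      then have "q' \<noteq> 0" using c by auto
      then have "degree [:c:] = degree g + degree q'" using g unfolding eq by (simp add: degree_mult_eq)
      then show False using deg by simp
    qed
    ultimately have pg: "p dvd g" by blast
    have "1 * d + 0 * p \<in> ?I" by blast
    then obtain c' q' where c': "c' \<noteq> 0" "[:c':] * d = g * q'" using div[of d] by auto
    then have "p dvd [:c':] * d" using pg by simp
    then have "p dvd [:c':]" using prime assms(3) by (simp only: prime_elem_dvd_mult_iff) simp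
    then have "degree p \<le> degree [:c':]" using c'(1) by (intro dvd_imp_degree_le) auto
    then show False using p by simp
  qed
  then obtain r where "g = [:r:]" by (metis degree_eq_zeroE)
  then show ?thesis using g that by auto
qed

lemma card_roots_rsquarefree:
  fixes q :: "complex poly"
  assumes "rsquarefree q"
  shows "card {z. poly q z = 0} = degree q"
proof -
  have q: "q \<noteq> 0" using assms by (auto simp: rsquarefree_def)
  have "degree q = degree (\<Prod>z|poly q z = 0. [:-z, 1:])"
    using complex_poly_decompose_rsquarefree[OF assms] q by (metis degree_smult_eq leading_coeff_0_iff)
  also have "\<dots> = card {z. poly q z = 0}"
    by (subst degree_prod_eq_sum_degree) auto
  finally show ?thesis by simp
qed

lemma poly_pderiv_slice: "poly (pderiv (map_poly (\<lambda>c. poly c z) p)) w = eval2 (pderiv p) (z, w)"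
proof -
  have "pderiv (map_poly (\<lambda>c. poly c z) p) = map_poly (\<lambda>c. poly c z) (pderiv p)"
    by (rule poly_eqI) (simp add: coeff_pderiv coeff_map_poly)
  then show ?thesis by (simp add: eval2_eq_poly_slice)
qed

lemma pderiv_poly_const: "pderiv (poly p [:w:]) = poly (map_poly pderiv p) [:w:]"
  by (induction p) (simp_all add: map_poly_pCons pderiv_add pderiv_smult)

lemma coeff_poly_const: "coeff (poly p [:w:]) j = poly (map_poly (\<lambda>c. coeff c j) p) w"
  by (induction p) (simp_all add: map_poly_pCons)

section \<open>Inner toral curves\<close>

locale inner_toral_curve =
  fixes p :: "complex poly poly" and n m :: nat
  assumes irred: "irreducible p" and toral: "inner_toral p" and bideg: "has_bidegree p n m"
    and n_pos: "0 < n" and m_pos: "0 < m"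
begin

lemma deg_w: "degree p = m" and deg_z: "degree_z p = n"
  using bideg by (auto simp: has_bidegree_def)

lemma p_nonzero: "p \<noteq> 0"
  using irred by auto

text \<open>
  Because of this, all roots of \<open>p(z, \<cdot>)\<close> for \<open>|z| < 1\<close> are points of the variety, so that the sizes of
  fibres can be computed by counting roots.
\<close>

lemma zero_in_bidisc:
  assumes "eval2 p (z, w) = 0" 
  shows "cmod z < 1 \<longleftrightarrow> cmod w < 1"
proof -
  have "(z, w) \<in> zero_set p" using assms by (simp add: zero_set_def)
  then show ?thesis using toral by (force simp: inner_toral_def)
qed

lemma slice_z_nonzero: "map_poly (\<lambda>c. poly c z) p \<noteq> 0"
proof
  assume "map_poly (\<lambda>c. poly c z) p = 0"
  then have "eval2 p (z, w) = 0" for w by (simp add: eval2_eq_poly_slice)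
  from zero_in_bidisc[OF this[of 0]] zero_in_bidisc[OF this[of 1]] show False by simp
qed

lemma slice_w_nonzero: "poly p [:w:] \<noteq> 0"
proof
  assume "poly p [:w:] = 0"
  then have "eval2 p (z, w) = 0" for z by (simp add: eval2_def)
  from zero_in_bidisc[OF this[of 0]] zero_in_bidisc[OF this[of 1]] show False by simp
qed

text \<open>
  Eliminating \<open>w\<close> leaves finitely many values of \<open>z\<close>, and over each of them \<open>p\<close> has finitely many zeros since it
  does not vanish on a whole line.
\<close>

lemma finite_common_zeros:
  assumes "\<not> p dvd d"
  shows "finite {x \<in> zero_set p. eval2 d x = 0}"
proof -
  obtain A B r where r: "r \<noteq> 0" "A * d + B * p = [:r:]"
    using eliminate_outer_variable[OF irred _ assms] m_pos deg_w by metis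
  have "{x \<in> zero_set p. eval2 d x = 0} \<subseteq> (SIGMA z:{z. poly r z = 0}. {w. poly (map_poly (\<lambda>c. poly c z) p) w = 0})"
  proof (clarsimp simp: zero_set_def)
    fix z w assume "eval2 p (z, w) = 0" "eval2 d (z, w) = 0"
    moreover then have "eval2 (A * d + B * p) (z, w) = 0" by (simp add: eval2_add eval2_mult)
    ultimately show "poly r z = 0 \<and> poly (map_poly (\<lambda>c. poly c z) p) w = 0"
      by (simp add: r eval2_poly_z) (simp add: eval2_eq_poly_slice)
  qed
  moreover have "finite \<dots>"
    using r slice_z_nonzero by (intro finite_SigmaI poly_roots_finite) auto
  ultimately show ?thesis by (rule finite_subset)
qed

text \<open>
  A fibre can have fewer than \<open>m\<close> points only if the leading coefficient of \<open>p\<close> in \<open>w\<close> vanishes at \<open>z\<close> or if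
  \<open>p\<close> and \<open>\<partial>p/\<partial>w\<close> have a common zero above \<open>z\<close>.
\<close>

lemma finite_bad_fibres_z:
  "\<exists>E. finite E \<and> (\<forall>z. cmod z < 1 \<longrightarrow> z \<notin> E \<longrightarrow>
     finite {x \<in> variety p. fst x = z} \<and> card {x \<in> variety p. fst x = z} = m)"
proof -
  let ?D = "{x \<in> zero_set p. eval2 (pderiv p) x = 0}"
  let ?E = "fst ` ?D \<union> {z. poly (coeff p m) z = 0}"
  have "\<not> p dvd pderiv p"
  proof
    assume "p dvd pderiv p"
    moreover have "pderiv p \<noteq> 0" using m_pos deg_w by (simp add: pderiv_eq_0_iff)
    ultimately have "degree p \<le> degree (pderiv p)" by (rule dvd_imp_degree_le)
    then show False using m_pos deg_w by (simp add: degree_pderiv)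
  qed
  then have "finite ?D" by (rule finite_common_zeros)
  moreover have "coeff p m \<noteq> 0" using p_nonzero deg_w by auto
  ultimately have "finite ?E" by (auto intro: poly_roots_finite)
  moreover have "finite {x \<in> variety p. fst x = z} \<and> card {x \<in> variety p. fst x = z} = m"
    if z: "cmod z < 1" "z \<notin> ?E" for z
  proof -
    let ?q = "map_poly (\<lambda>c. poly c z) p"
    have root: "poly ?q w = 0 \<longleftrightarrow> eval2 p (z, w) = 0" for w by (simp add: eval2_eq_poly_slice)
    have "poly (coeff p m) z \<noteq> 0" using z by auto
    then have deg: "degree ?q = m" using deg_w
      by (intro antisym degree_le le_degree allI impI) (auto simp: coeff_map_poly coeff_eq_0)
    have "rsquarefree ?q"
      unfolding rsquarefree_roots
    proof (intro allI notI, elim conjE)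
      fix w assume "poly ?q w = 0" "poly (pderiv ?q) w = 0"
      then have "(z, w) \<in> ?D" by (simp add: root poly_pderiv_slice zero_set_def)
      then show False using z by force
    qed
    then have "card {w. poly ?q w = 0} = m" using card_roots_rsquarefree deg by simp
    moreover have "{x \<in> variety p. fst x = z} = Pair z ` {w. poly ?q w = 0}"
      using zero_in_bidisc z by (auto simp: variety_def zero_set_def root)
    moreover have "finite {w. poly ?q w = 0}" using slice_z_nonzero by (rule poly_roots_finite)
    ultimately show ?thesis by (simp add: card_image inj_on_def)
  qed
  ultimately show ?thesis by blast
qed

text \<open>
  As for \<open>z\<close>, but with \<open>p\<close> regarded as a polynomial in the inner variable. Here \<open>p\<close> does not divide
  \<open>\<partial>p/\<partial>z\<close> because, after specialisation of \<open>w\<close>, a nonconstant polynomial would divide its own derivative.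
\<close>

lemma finite_bad_fibres_w:
  "\<exists>E. finite E \<and> (\<forall>w. cmod w < 1 \<longrightarrow> w \<notin> E \<longrightarrow>
     finite {x \<in> variety p. snd x = w} \<and> card {x \<in> variety p. snd x = w} = n)"
proof -
  let ?D = "{x \<in> zero_set p. eval2 (map_poly pderiv p) x = 0}"
  let ?l = "map_poly (\<lambda>c. coeff c n) p"
  let ?E = "snd ` ?D \<union> {w. poly ?l w = 0}"
  have deg_le: "degree (coeff p i) \<le> n" for i
  proof (cases "i \<le> degree p")
    case True
    then show ?thesis using deg_z unfolding degree_z_def by (auto intro: Max_ge)
  qed (simp add: coeff_eq_0)
  have "n \<in> (\<lambda>i. degree (coeff p i)) ` {..degree p}"
    using deg_z unfolding degree_z_def by (metis Max_in finite_atMost finite_imageI image_is_empty atMost_iff empty_iff le_refl)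
  then obtain i where "degree (coeff p i) = n" by blast
  then have "coeff (coeff p i) n \<noteq> 0" using n_pos by auto
  then have "coeff ?l i \<noteq> 0" by (simp add: coeff_map_poly)
  then have l: "?l \<noteq> 0" by auto
  have deg: "degree (poly p [:w:]) = n" if "poly ?l w \<noteq> 0" for w
  proof (rule antisym)
    have "coeff (poly p [:w:]) j = 0" if "n < j" for j
    proof -
      have "map_poly (\<lambda>c. coeff c j) p = 0"
        using that le_less_trans[OF deg_le that] by (intro poly_eqI) (simp add: coeff_map_poly coeff_eq_0)
      then show ?thesis by (simp add: coeff_poly_const)
    qed
    then show "degree (poly p [:w:]) \<le> n" by (intro degree_le) auto
    show "n \<le> degree (poly p [:w:])" using that by (intro le_degree) (simp add: coeff_poly_const)
  qed
  have "\<not> p dvd map_poly pderiv p"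
  proof
    assume "p dvd map_poly pderiv p"
    then obtain c where c: "map_poly pderiv p = p * c" by blast
    obtain w where w: "poly ?l w \<noteq> 0" using l poly_all_0_iff_0 by blast
    have "poly p [:w:] dvd pderiv (poly p [:w:])" by (simp add: pderiv_poly_const c)
    moreover have "pderiv (poly p [:w:]) \<noteq> 0" using deg[OF w] n_pos by (simp add: pderiv_eq_0_iff)
    ultimately have "degree (poly p [:w:]) \<le> degree (pderiv (poly p [:w:]))" by (rule dvd_imp_degree_le)
    then show False using deg[OF w] n_pos by (simp add: degree_pderiv)
  qed
  then have "finite ?D" by (rule finite_common_zeros)
  then have "finite ?E" using l by (auto intro: poly_roots_finite)
  moreover have "finite {x \<in> variety p. snd x = w} \<and> card {x \<in> variety p. snd x = w} = n"
    if w: "cmod w < 1" "w \<notin> ?E" for w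
  proof -
    let ?q = "poly p [:w:]"
    have root: "poly ?q z = 0 \<longleftrightarrow> eval2 p (z, w) = 0" for z by (simp add: eval2_def)
    have "rsquarefree ?q"
      unfolding rsquarefree_roots
    proof (intro allI notI, elim conjE)
      fix z assume "poly ?q z = 0" "poly (pderiv ?q) z = 0"
      then have "(z, w) \<in> ?D" by (simp add: pderiv_poly_const zero_set_def eval2_def)
      then show False using w by force
    qed
    then have "card {z. poly ?q z = 0} = n" using card_roots_rsquarefree deg w by simp
    moreover have "{x \<in> variety p. snd x = w} = (\<lambda>z. (z, w)) ` {z. poly ?q z = 0}"
      using zero_in_bidisc w by (auto simp: variety_def zero_set_def root)
    moreover have "finite {z. poly ?q z = 0}" using slice_w_nonzero by (rule poly_roots_finite)
    ultimately show ?thesis by (simp add: card_image inj_on_def)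
  qed
  ultimately show ?thesis by blast
qed

end

section \<open>Polynomial matrices of full row rank\<close>

lemma full_row_rank_right_inverse:
  fixes A :: "complex ^ 'b ^ 'a"
  assumes "rank A = CARD('a)"
  obtains B :: "complex ^ 'a ^ 'b" where "A ** B = mat 1"
proof -
  have img: "rows A = (\<lambda>i. row i A) ` UNIV" by (auto simp: rows_def)
  then have fin: "finite (rows A)" by simp
  have "CARD('a) \<le> card (rows A)"
    using assms vec.dim_le_card'[OF fin] by (simp add: row_rank_def_gen)
  then have card: "card (rows A) = CARD('a)"
    using card_image_le[of UNIV "\<lambda>i. row i A"] unfolding img by simp
  then have inj: "inj (\<lambda>i. row i A)" unfolding img by (rule eq_card_imp_inj_on[rotated]) simp
  have "vec.independent (rows A)"
    using fin card assms by (subst vec.card_eq_dim[of "rows A" "rows A"]) (auto simp: row_rank_def_gen vec.span_superset)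
  then have "\<forall>c. (\<Sum>i\<in>UNIV. c i *s row i A) = 0 \<longrightarrow> (\<forall>i. c i = 0)"
  proof (intro allI impI)
    fix c i assume "vec.independent (rows A)" and 0: "(\<Sum>i\<in>UNIV. c i *s row i A) = 0"
    have "(\<Sum>v\<in>rows A. c (inv (\<lambda>i. row i A) v) *s v) = 0"
      using 0 inj unfolding img by (simp add: sum.reindex inv_f_f[OF inj])
    from vec.independentD[OF \<open>vec.independent (rows A)\<close> fin subset_refl this, of "row i A"]
    show "c i = 0" by (auto simp: img inv_f_f[OF inj])
  qed
  then show ?thesis using that matrix_right_invertible_independent_rows[of A] by blast
qed

lemma eval_mat_times_const:
  "eval_mat A x ** B = eval_mat (\<chi> i j. \<Sum>b\<in>UNIV. A $ i $ b * [:[:B $ b $ j:]:]) x"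
  by (simp add: eval_mat_def matrix_matrix_mult_def eval2_sum eval2_smult mult.commute)

lemma adj_injective_if_det_nonzero:
  assumes "det (A ** B) \<noteq> 0" "adj_mat A *v v = 0"
  shows "v = 0"
proof -
  obtain C where "(A ** B) ** C = mat 1"
    using assms(1) invertible_det_nz[of "A ** B"] by (auto simp: invertible_def)
  then have "cdot v u = 0" for u
  proof -
    have "u = A *v (B *v (C *v u))"
      using \<open>(A ** B) ** C = mat 1\<close> by (metis matrix_vector_mul_assoc matrix_vector_mul_lid)
    then have "cdot u v = cdot (B *v (C *v u)) (adj_mat A *v v)" by (metis cdot_adj)
    then show ?thesis using assms(2) cdot_commute[of v u] by simp
  qed
  then show ?thesis by (metis cdot_self_eq_0_iff)
qed

text \<open>
  Multiplication by a right inverse of \<open>A(x\<^sub>0)\<close> replaces the selection of a nonvanishing minor: the polynomial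
  \<open>d = det (A B)\<close> takes the value \<open>1\<close> at \<open>x\<^sub>0\<close>.
\<close>

lemma (in inner_toral_curve) finite_rank_drop:
  fixes A :: "complex poly poly ^ 'b ^ 'a"
  assumes x0: "x0 \<in> variety p" and B: "eval_mat A x0 ** B = mat 1"
  obtains d where "\<And>x. eval2 d x = det (eval_mat A x ** B)" "\<not> p dvd d"
    "finite {x \<in> variety p. det (eval_mat A x ** B) = 0}"
proof -
  define d where "d = det (\<chi> i j. \<Sum>b\<in>UNIV. A $ i $ b * [:[:B $ b $ j:]:])"
  have d: "eval2 d x = det (eval_mat A x ** B)" for x
    by (simp add: d_def eval2_det eval_mat_times_const)
  have "\<not> p dvd d"
  proof
    assume "p dvd d"
    then have "eval2 d x0 = 0" using x0 by (auto simp: eval2_mult variety_def zero_set_def)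
    then show False by (simp add: d B)
  qed
  moreover have "{x \<in> variety p. det (eval_mat A x ** B) = 0} \<subseteq> {x \<in> zero_set p. eval2 d x = 0}"
    by (auto simp: variety_def d)
  ultimately show ?thesis using that[OF d] finite_subset[OF _ finite_common_zeros] by blast
qed

lemma (in inner_toral_curve) finite_adj_not_injective:
  fixes A :: "complex poly poly ^ 'b ^ 'a"
  assumes "x0 \<in> variety p" "rank (eval_mat A x0) = CARD('a)"
  shows "finite {x \<in> variety p. \<exists>v. v \<noteq> 0 \<and> adj_mat (eval_mat A x) *v v = 0}"
proof -
  obtain B where B: "eval_mat A x0 ** B = mat 1" using full_row_rank_right_inverse[OF assms(2)] .
  then have "finite {x \<in> variety p. det (eval_mat A x ** B) = 0}"
    using finite_rank_drop[OF assms(1)] by blast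
  then show ?thesis
    by (rule rev_finite_subset) (use adj_injective_if_det_nonzero in blast)
qed

section \<open>The space of an admissible kernel\<close>

lemma small_point_avoiding_finite:
  assumes "finite (E :: complex set)" "0 < e"
  obtains \<zeta> where "0 < cmod \<zeta>" "cmod \<zeta> < e" "\<zeta> \<notin> E"
proof -
  have "infinite (complex_of_real ` {0<..<e})"
    using assms(2) by (subst finite_image_iff) (auto simp: inj_on_def)
  then have "\<not> complex_of_real ` {0<..<e} \<subseteq> E" using assms(1) finite_subset by metis
  then obtain \<zeta> where "\<zeta> \<in> complex_of_real ` {0<..<e}" "\<zeta> \<notin> E" by blast
  then show ?thesis by (intro that) auto
qed

lemma mult_z_eq: "mult_z = mul fst" and mult_w_eq: "mult_w = mul snd"
  by (simp_all add: fun_eq_iff mult_z_def mult_w_def mul_def)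

lemma mul_funpow: "(mul g ^^ k) f = mul (\<lambda>x. g x ^ k) f"
  by (induction k) (simp_all add: mul_one mul_mul)

lemma eval2_altdef:
  "eval2 q x = (\<Sum>i\<le>degree q. \<Sum>j\<le>degree (coeff q i). coeff (coeff q i) j * (fst x ^ j * snd x ^ i))"
proof -
  have "eval2 q x = (\<Sum>i\<le>degree q. poly (coeff q i) (fst x) * snd x ^ i)"
    by (simp add: eval2_def poly_altdef[of q] poly_sum)
  also have "\<dots> = (\<Sum>i\<le>degree q. \<Sum>j\<le>degree (coeff q i). coeff (coeff q i) j * (fst x ^ j * snd x ^ i))"
    by (simp add: poly_altdef[of "coeff q _"] sum_distrib_right mult.assoc)
  finally show ?thesis .
qed

locale admissible_rkhs = inner_toral_curve p n m + rkhs H ip "variety p" K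
  for p n m and H :: "(complex \<times> complex \<Rightarrow> complex ^ 'a) set" and ip K +
  fixes Q :: "complex poly poly ^ 'b ^ 'a" and P :: "complex poly poly ^ 'c ^ 'a"
  assumes admissible: "admissible_kernel p n m CARD('a) Q P K"
begin

lemma factor_z:
  assumes "x \<in> variety p" "y \<in> variety p"
  shows "(1 - fst x * cnj (fst y)) *s (K x y *v v) = eval_mat Q x *v (adj_mat (eval_mat Q y) *v v)"
proof (rule clear_kernel_denominator)
  show "cmod (fst x) < 1" "cmod (fst y) < 1" using assms by (auto simp: variety_def)
  show "K x y $ i $ j = (eval_mat Q x ** adj_mat (eval_mat Q y)) $ i $ j / (1 - fst x * cnj (fst y))" for i j
    using admissible assms unfolding admissible_kernel_def by blast
qed

lemma factor_w:
  assumes "x \<in> variety p" "y \<in> variety p"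
  shows "(1 - snd x * cnj (snd y)) *s (K x y *v v) = eval_mat P x *v (adj_mat (eval_mat P y) *v v)"
proof (rule clear_kernel_denominator)
  show "cmod (snd x) < 1" "cmod (snd y) < 1" using assms by (auto simp: variety_def)
  show "K x y $ i $ j = (eval_mat P x ** adj_mat (eval_mat P y)) $ i $ j / (1 - snd x * cnj (snd y))" for i j
    using admissible assms unfolding admissible_kernel_def by blast
qed

lemma generic_fibres_z:
  obtains E where "finite E" "\<And>z. cmod z < 1 \<Longrightarrow> z \<notin> E \<Longrightarrow>
    finite {x \<in> variety p. fst x = z} \<and> card {x \<in> variety p. fst x = z} = m \<and>
    (\<forall>x\<in>variety p. fst x = z \<longrightarrow> (\<forall>v. adj_mat (eval_mat Q x) *v v = 0 \<longrightarrow> v = 0))"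
proof -
  obtain x0 where "x0 \<in> variety p" "rank (eval_mat Q x0) = CARD('a)"
    using admissible unfolding admissible_kernel_def by blast
  then have D: "finite {x \<in> variety p. \<exists>v. v \<noteq> 0 \<and> adj_mat (eval_mat Q x) *v v = 0}" (is "finite ?D")
    by (rule finite_adj_not_injective)
  obtain E where E: "finite E" "\<And>z. cmod z < 1 \<Longrightarrow> z \<notin> E \<Longrightarrow>
    finite {x \<in> variety p. fst x = z} \<and> card {x \<in> variety p. fst x = z} = m"
    using finite_bad_fibres_z by blast
  show ?thesis by (rule that[of "E \<union> fst ` ?D"]) (use D E in blast)+
qed

lemma generic_fibres_w:
  obtains E where "finite E" "\<And>w. cmod w < 1 \<Longrightarrow> w \<notin> E \<Longrightarrow>
    finite {x \<in> variety p. snd x = w} \<and> card {x \<in> variety p. snd x = w} = n \<and>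
    (\<forall>x\<in>variety p. snd x = w \<longrightarrow> (\<forall>v. adj_mat (eval_mat P x) *v v = 0 \<longrightarrow> v = 0))"
proof -
  obtain x0 where "x0 \<in> variety p" "rank (eval_mat P x0) = CARD('a)"
    using admissible unfolding admissible_kernel_def by blast
  then have D: "finite {x \<in> variety p. \<exists>v. v \<noteq> 0 \<and> adj_mat (eval_mat P x) *v v = 0}" (is "finite ?D")
    by (rule finite_adj_not_injective)
  obtain E where E: "finite E" "\<And>w. cmod w < 1 \<Longrightarrow> w \<notin> E \<Longrightarrow>
    finite {x \<in> variety p. snd x = w} \<and> card {x \<in> variety p. snd x = w} = n"
    using finite_bad_fibres_w by blast
  show ?thesis by (rule that[of "E \<union> snd ` ?D"]) (use D E in blast)+
qed

sublocale z: coordinate_factorization H ip "variety p" K fst snd "eval_mat Q"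
proof
  show "cmod (fst x) < 1" if "x \<in> variety p" for x using that by (auto simp: variety_def)
  show "mul snd f \<in> H" if "f \<in> H" for f
    using mul_contraction(1)[of snd "eval_mat P" f] factor_w that by blast
  fix e :: real assume "0 < e"
  obtain E where E: "finite E" "\<And>z. cmod z < 1 \<Longrightarrow> z \<notin> E \<Longrightarrow>
    finite {x \<in> variety p. fst x = z} \<and> card {x \<in> variety p. fst x = z} = m \<and>
    (\<forall>x\<in>variety p. fst x = z \<longrightarrow> (\<forall>v. adj_mat (eval_mat Q x) *v v = 0 \<longrightarrow> v = 0))"
    using generic_fibres_z by blast
  obtain \<zeta> where z: "0 < cmod \<zeta>" "cmod \<zeta> < min e 1" "\<zeta> \<notin> E"
    using small_point_avoiding_finite[OF E(1), of "min e 1"] \<open>0 < e\<close> by auto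
  have "CARD('b) = m * CARD('a)" using admissible by (simp add: admissible_kernel_def)
  then show "\<exists>\<zeta> F. 0 < cmod \<zeta> \<and> cmod \<zeta> < e \<and> finite F \<and> F \<subseteq> variety p \<and> (\<forall>x\<in>F. fst x = \<zeta>) \<and>
      inj_on snd F \<and> card F * CARD('a) = CARD('b) \<and>
      (\<forall>x\<in>F. \<forall>v. adj_mat (eval_mat Q x) *v v = 0 \<longrightarrow> v = 0)"
    using z E(2)[of \<zeta>]
    by (intro exI[of _ \<zeta>] exI[of _ "{x \<in> variety p. fst x = \<zeta>}"]) (auto simp: inj_on_def)
qed (rule factor_z)

sublocale w: coordinate_factorization H ip "variety p" K snd fst "eval_mat P"
proof
  show "cmod (snd x) < 1" if "x \<in> variety p" for x using that by (auto simp: variety_def)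
  show "mul fst f \<in> H" if "f \<in> H" for f by (rule z.mul_g_closed[OF that])
  fix e :: real assume "0 < e"
  obtain E where E: "finite E" "\<And>w. cmod w < 1 \<Longrightarrow> w \<notin> E \<Longrightarrow>
    finite {x \<in> variety p. snd x = w} \<and> card {x \<in> variety p. snd x = w} = n \<and>
    (\<forall>x\<in>variety p. snd x = w \<longrightarrow> (\<forall>v. adj_mat (eval_mat P x) *v v = 0 \<longrightarrow> v = 0))"
    using generic_fibres_w by blast
  obtain \<zeta> where z: "0 < cmod \<zeta>" "cmod \<zeta> < min e 1" "\<zeta> \<notin> E"
    using small_point_avoiding_finite[OF E(1), of "min e 1"] \<open>0 < e\<close> by auto
  have "CARD('c) = n * CARD('a)" using admissible by (simp add: admissible_kernel_def)
  then show "\<exists>\<zeta> F. 0 < cmod \<zeta> \<and> cmod \<zeta> < e \<and> finite F \<and> F \<subseteq> variety p \<and> (\<forall>x\<in>F. snd x = \<zeta>) \<and>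
      inj_on fst F \<and> card F * CARD('a) = CARD('c) \<and>
      (\<forall>x\<in>F. \<forall>v. adj_mat (eval_mat P x) *v v = 0 \<longrightarrow> v = 0)"
    using z E(2)[of \<zeta>]
    by (intro exI[of _ \<zeta>] exI[of _ "{x \<in> variety p. snd x = \<zeta>}"]) (auto simp: inj_on_def)
qed (rule factor_w)

lemma commuting_isometries_mult: "commuting_isometries mult_z mult_w"
proof -
  have "isometric_operator (mul fst)"
    unfolding isometric_operator_def
    by (simp add: z.mul_g_closed z.mul_g_isometric mul_add mul_fun_scale)
  moreover have "isometric_operator (mul snd)"
    unfolding isometric_operator_def
    by (simp add: w.mul_g_closed w.mul_g_isometric mul_add mul_fun_scale)
  ultimately show ?thesis
    by (simp add: commuting_isometries_def mult_z_eq mult_w_eq mul_mul mult.commute)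
qed

lemma poly_op_eq: "poly_op q mult_z mult_w f = mul (eval2 q) f"
  by (rule ext) (simp add: poly_op_def mult_z_eq mult_w_eq mul_funpow mul_mul fun_sum_apply
      fun_scale_def mul_def eval2_altdef vec.scale_sum_left)

lemma mul_eval2_closed: "f \<in> H \<Longrightarrow> mul (eval2 q) f \<in> H"
proof -
  assume f: "f \<in> H"
  have pw: "(mul fst ^^ j) g \<in> H" "(mul snd ^^ j) g \<in> H" if "g \<in> H" for g j
    using that by (induction j) (auto intro: z.mul_g_closed w.mul_g_closed)
  show ?thesis
    unfolding poly_op_eq[symmetric] poly_op_def mult_z_eq mult_w_eq
    by (intro H_sum H_scale pw f)
qed

lemma cyclic_span_eq:
  "cyclic_span mult_z mult_w k f = {\<Sum>j<k. mul (eval2 (q j)) (f j) | q. True}"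
  by (simp add: cyclic_span_def poly_op_eq)

lemma cyclic_span_subset: "f ` {..<k} \<subseteq> H \<Longrightarrow> cyclic_span mult_z mult_w k f \<subseteq> H"
  unfolding cyclic_span_eq by (auto intro!: H_sum mul_eval2_closed)

lemma subspace_cyclic_span: "subspace (cyclic_span mult_z mult_w k f)"
  unfolding subspace_def cyclic_span_eq
proof (intro conjI ballI allI)
  have "0 = (\<Sum>j<k. mul (eval2 0) (f j))" by (simp add: mul_def eval2_zero fun_eq_iff fun_sum_apply)
  then show "0 \<in> {\<Sum>j<k. mul (eval2 (q j)) (f j) | q. True}"
    by (intro CollectI exI[of _ "\<lambda>_. 0"]) simp
next
  fix x y assume "x \<in> {\<Sum>j<k. mul (eval2 (q j)) (f j) | q. True}" "y \<in> {\<Sum>j<k. mul (eval2 (q j)) (f j) | q. True}"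
  then obtain q q' where "x = (\<Sum>j<k. mul (eval2 (q j)) (f j))" "y = (\<Sum>j<k. mul (eval2 (q' j)) (f j))"
    by blast
  then have "x + y = (\<Sum>j<k. mul (eval2 (q j + q' j)) (f j))"
    by (simp add: fun_eq_iff fun_sum_apply mul_def eval2_add vec.scale_left_distrib sum.distrib)
  then show "x + y \<in> {\<Sum>j<k. mul (eval2 (q j)) (f j) | q. True}"
    by (intro CollectI exI[of _ "\<lambda>j. q j + q' j"]) simp
next
  fix c x assume "x \<in> {\<Sum>j<k. mul (eval2 (q j)) (f j) | q. True}"
  then obtain q where "x = (\<Sum>j<k. mul (eval2 (q j)) (f j))" by blast
  then have "fun_scale c x = (\<Sum>j<k. mul (eval2 ([:[:c:]:] * q j)) (f j))"
    by (simp add: fun_eq_iff fun_sum_apply fun_scale_def mul_def eval2_smult vec.scale_sum_right)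
  then show "fun_scale c x \<in> {\<Sum>j<k. mul (eval2 (q j)) (f j) | q. True}"
    by (intro CollectI exI[of _ "\<lambda>j. [:[:c:]:] * q j"]) simp
qed

end

section \<open>Fewer than \<open>\<alpha>\<close> functions leave infinite codimension\<close>

lemma homogeneous_system_nontrivial_solution:
  fixes a :: "'f \<Rightarrow> 'i \<Rightarrow> 'k::field"
  assumes "finite F" "finite I" "card F < card I"
  shows "\<exists>c. (\<exists>i\<in>I. c i \<noteq> 0) \<and> (\<forall>f\<in>F. (\<Sum>i\<in>I. a f i * c i) = 0)"
  using assms
proof (induction F arbitrary: I a rule: finite_induct)
  case empty
  then have "I \<noteq> {}" by auto
  then show ?case by (intro exI[of _ "\<lambda>_. 1"]) auto
next
  case (insert f F)
  show ?case
  proof (cases "\<forall>i\<in>I. a f i = 0")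
    case True
    have "card F < card I" using insert by simp
    then obtain c where "\<exists>i\<in>I. c i \<noteq> 0" "\<forall>g\<in>F. (\<Sum>i\<in>I. a g i * c i) = 0"
      using insert.IH[OF insert.prems(1), of a] by blast
    then show ?thesis using True by (intro exI[of _ c]) auto
  next
    case False
    then obtain j where j: "j \<in> I" "a f j \<noteq> 0" by blast
    define b where "b g i = a g i - a f i / a f j * a g j" for g i
    have "card F < card (I - {j})" using insert j by simp
    then obtain c where c: "\<exists>i\<in>I - {j}. c i \<noteq> 0" "\<forall>g\<in>F. (\<Sum>i\<in>I - {j}. b g i * c i) = 0"
      using insert.IH[of "I - {j}" b] insert.prems by auto
    define s where "s = (\<Sum>i\<in>I - {j}. a f i * c i) / a f j"
    have eq: "(\<Sum>i\<in>I. a g i * (c(j := - s)) i) = (\<Sum>i\<in>I - {j}. a g i * c i) - a g j * s" for g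
      using insert.prems j by (subst sum.remove[of I j]) (auto intro!: sum.cong)
    have "(\<Sum>i\<in>I. a f i * (c(j := - s)) i) = 0" unfolding eq using j by (simp add: s_def)
    moreover have "(\<Sum>i\<in>I. a g i * (c(j := - s)) i) = 0" if "g \<in> F" for g
    proof -
      have "0 = (\<Sum>i\<in>I - {j}. b g i * c i)" using c(2) that by simp
      also have "\<dots> = (\<Sum>i\<in>I - {j}. a g i * c i - a f i * c i * (a g j / a f j))"
        by (intro sum.cong refl) (simp add: b_def left_diff_distrib)
      also have "\<dots> = (\<Sum>i\<in>I - {j}. a g i * c i) - (\<Sum>i\<in>I - {j}. a f i * c i * (a g j / a f j))"
        by (rule sum_subtractf)
      also have "(\<Sum>i\<in>I - {j}. a f i * c i * (a g j / a f j)) = a g j * s"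
        by (simp only: s_def sum_distrib_right[symmetric]) simp
      finally show ?thesis unfolding eq by simp
    qed
    moreover have "\<exists>i\<in>I. (c(j := - s)) i \<noteq> 0" using c(1) by auto
    ultimately show ?thesis by blast
  qed
qed

context admissible_rkhs
begin

text \<open>
  If the closure of the module generated by \<open>l < \<alpha>\<close> functions had finite codimension, spanned modulo the closure
  by \<open>F\<close>, then among \<open>|F| + 1\<close> kernel sections orthogonal to the module there would be a nontrivial combination
  orthogonal to \<open>F\<close> as well, hence to the whole space. Pairing it with a function that vanishes at all
  but one of the points contradicts the nontriviality.
\<close>

lemma at_least_nearly_cyclic_mult: "at_least_nearly_cyclic mult_z mult_w CARD('a)"
  unfolding at_least_nearly_cyclic_def
proof (intro conjI allI impI notI commuting_isometries_mult)
  fix l f assume l: "l < CARD('a)" and fH: "f ` {..<l} \<subseteq> H"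
    and codim: "finite_codim (mtopology closure_of cyclic_span mult_z mult_w l f)"
  let ?N = "cyclic_span mult_z mult_w l f"
  obtain F where F: "finite F" "F \<subseteq> H" "\<forall>h\<in>H. \<exists>g\<in>span F. h - g \<in> mtopology closure_of ?N"
    using codim unfolding finite_codim_def by blast
  obtain E where E: "finite E" "\<And>z. cmod z < 1 \<Longrightarrow> z \<notin> E \<Longrightarrow>
    finite {x \<in> variety p. fst x = z} \<and> card {x \<in> variety p. fst x = z} = m \<and>
    (\<forall>x\<in>variety p. fst x = z \<longrightarrow> (\<forall>v. adj_mat (eval_mat Q x) *v v = 0 \<longrightarrow> v = 0))"
    using generic_fibres_z by blast
  have "infinite (ball (0::complex) 1 - E)"
    using E(1) uncountable_ball[of 1 "0::complex"] by (intro Diff_infinite_finite) (auto dest: countable_finite)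
  then obtain Z where Z: "finite Z" "card Z = Suc (card F)" "Z \<subseteq> ball 0 1 - E"
    by (metis infinite_arbitrarily_large)
  have "\<exists>x\<in>variety p. fst x = z" if "z \<in> Z" for z
  proof -
    have "cmod z < 1" "z \<notin> E" using Z that by auto
    then have "card {x \<in> variety p. fst x = z} = m" using E(2) by blast
    then have "{x \<in> variety p. fst x = z} \<noteq> {}" using m_pos by (metis card.empty less_irrefl)
    then show ?thesis by blast
  qed
  then obtain y where y: "\<And>z. z \<in> Z \<Longrightarrow> y z \<in> variety p" "\<And>z. z \<in> Z \<Longrightarrow> fst (y z) = z" by metis
  have "\<exists>v. v \<noteq> 0 \<and> (\<forall>j<l. cdot (f j (y z)) v = 0)" for z
  proof -
    obtain c where c: "\<exists>i. c i \<noteq> 0" "\<forall>j\<in>{..<l}. (\<Sum>i\<in>UNIV. f j (y z) $ i * c i) = 0"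
      using homogeneous_system_nontrivial_solution[of "{..<l}" "UNIV :: 'a set" "\<lambda>j i. f j (y z) $ i"] l by auto
    then show ?thesis
      by (intro exI[of _ "\<chi> i. cnj (c i)"]) (auto simp: cdot_def vec_eq_iff)
  qed
  then obtain v where v: "\<And>z. v z \<noteq> 0" "\<And>z j. j < l \<Longrightarrow> cdot (f j (y z)) (v z) = 0" by metis
  let ?k = "\<lambda>z. kernel_section (variety p) K (y z) (v z)"
  have kH: "?k z \<in> H" if "z \<in> Z" for z using y(1)[OF that] by (rule kernel_section_in)
  have k_perp: "?k z \<in> perp ?N" if "z \<in> Z" for z
  proof -
    have "ip d (?k z) = 0" if d: "d \<in> ?N" for d
    proof -
      obtain q where q: "d = (\<Sum>j<l. mul (eval2 (q j)) (f j))" using d by (auto simp: cyclic_span_eq)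
      have "d \<in> H" using cyclic_span_subset[OF fH] d by blast
      then have "ip d (?k z) = cdot (d (y z)) (v z)" using y(1)[OF \<open>z \<in> Z\<close>] by (rule ip_section)
      also have "\<dots> = 0" by (simp add: q fun_sum_apply cdot_sum_left mul_def cdot_scale_left v)
      finally show ?thesis .
    qed
    then show ?thesis using kH[OF that] by (simp add: perp_def)
  qed
  obtain c where c: "\<exists>z\<in>Z. c z \<noteq> 0" "\<forall>g\<in>F. (\<Sum>z\<in>Z. ip g (?k z) * c z) = 0"
    using homogeneous_system_nontrivial_solution[OF F(1) Z(1), of "\<lambda>g z. ip g (?k z)"] Z(2) by auto
  define G where "G = (\<Sum>z\<in>Z. fun_scale (cnj (c z)) (?k z))"
  have GH: "G \<in> H" unfolding G_def by (intro H_sum H_scale kH)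
  have ipG: "ip h G = (\<Sum>z\<in>Z. ip h (?k z) * c z)" if "h \<in> H" for h
    using that kH by (simp add: G_def ip_sum_right H_scale ip_scale_right mult.commute)
  have G_perp: "G \<in> perp ?N"
  proof -
    have "ip d G = 0" if "d \<in> ?N" for d
      using ipG[of d] that cyclic_span_subset[OF fH] k_perp by (auto simp: perp_def intro!: sum.neutral)
    then show ?thesis using GH by (simp add: perp_def)
  qed
  have "subspace {h \<in> H. ip h G = 0}"
    unfolding subspace_def using GH by (auto simp: H_zero H_add H_scale ip_zero_left ip_add ip_scale)
  moreover have "F \<subseteq> {h \<in> H. ip h G = 0}" using F(2) c(2) ipG by auto
  ultimately have span: "span F \<subseteq> {h \<in> H. ip h G = 0}" by (rule span_minimal[rotated])
  have zero: "ip h G = 0" if h: "h \<in> H" for h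
  proof -
    obtain g where g: "g \<in> span F" "h - g \<in> mtopology closure_of ?N" using F(3) h by blast
    have "ip (h - g) G = 0" using closure_perp_eq_0[OF cyclic_span_subset[OF fH] g(2) G_perp] .
    then show ?thesis using span g(1) h GH by (auto simp: ip_diff)
  qed
  obtain z0 where z0: "z0 \<in> Z" "c z0 \<noteq> 0" using c by blast
  have inj: "inj_on fst (y ` Z)" using y(2) by (auto simp: inj_on_def)
  obtain h a where h: "h \<in> H" "a \<noteq> 0" "h (y z0) = a *s ?k z0 (y z0)"
    "\<And>x. x \<in> y ` Z \<Longrightarrow> x \<noteq> y z0 \<Longrightarrow> h x = 0"
    using isolating_multiplier[OF z.mul_g_closed _ inj _ kH[OF z0(1)], of "y z0"] Z(1) z0(1) by blast
  have "0 = (\<Sum>z\<in>Z. ip h (?k z) * c z)" using zero[OF h(1)] ipG[OF h(1)] by simp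
  also have "\<dots> = (\<Sum>z\<in>{z0}. ip h (?k z) * c z)"
  proof (rule sum.mono_neutral_right)
    show "\<forall>z\<in>Z - {z0}. ip h (?k z) * c z = 0"
    proof
      fix z assume z: "z \<in> Z - {z0}"
      then have "y z \<noteq> y z0" using y(2) z0 by (metis DiffE singletonI)
      then have "h (y z) = 0" using h(4) z by blast
      then show "ip h (?k z) * c z = 0" using z y(1) h(1) by (simp add: ip_section)
    qed
  qed (use Z z0 in auto)
  also have "\<dots> = a * cdot (?k z0 (y z0)) (v z0) * c z0"
    using h y(1)[OF z0(1)] by (simp add: ip_section cdot_scale_left)
  finally have "cdot (?k z0 (y z0)) (v z0) = 0" using h(2) z0(2) by simp
  then have "adj_mat (eval_mat Q (y z0)) *v v z0 = 0"
    by (rule z.section_self_zero_imp[OF y(1)[OF z0(1)]])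
  moreover have "cmod z0 < 1" "z0 \<notin> E" using Z z0 by auto
  ultimately have "v z0 = 0" using E(2)[of z0] y z0(1) by blast
  then show False using v by blast
qed

end

section \<open>Finite codimension from \<open>\<alpha>\<close> generators\<close>

lemma cramer_on_columns:
  fixes M :: "complex ^ 'k ^ 'k"
  assumes "det M \<noteq> 0"
  shows "det M *s y = (\<Sum>k\<in>UNIV. det (\<chi> i j. if j = k then y $ i else M $ i $ j) *s column k M)"
proof -
  let ?u = "\<chi> k. det (\<chi> i j. if j = k then y $ i else M $ i $ j) / det M"
  have "M *v ?u = y" using cramer[OF assms] by blast
  then have "y = (\<Sum>k\<in>UNIV. ?u $ k *s column k M)" by (simp add: matrix_mult_sum)
  then have "det M *s y = det M *s (\<Sum>k\<in>UNIV. ?u $ k *s column k M)" by (rule arg_cong)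
  also have "\<dots> = (\<Sum>k\<in>UNIV. det (\<chi> i j. if j = k then y $ i else M $ i $ j) *s column k M)"
    using assms by (simp add: vec.scale_sum_right)
  finally show ?thesis .
qed

context admissible_rkhs
begin

text \<open>
  Where \<open>d = det (Q B)\<close> is nonzero, Cramer's rule writes \<open>d Q a\<close> as a polynomial combination of the
  columns of \<open>Q B\<close>. Elimination of \<open>w\<close> gives \<open>r\<^sub>0 = A d\<close> on the variety, with \<open>r\<^sub>0\<close> a polynomial in \<open>z\<close>
  alone. The square of \<open>r\<^sub>0\<close> is taken for \<open>r\<close> so that one factor \<open>d\<close> remains on both sides, which makes the
  identity true also at the zeros of \<open>d\<close>.
\<close>

lemma clear_into_generators:
  obtains r and B :: "complex ^ 'a ^ 'b" where "r \<noteq> 0" "inj (\<lambda>i. z.Lfun (B *v axis i 1))"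
    "\<And>a. \<exists>c. mul (\<lambda>x. poly r (fst x)) (z.Lfun a) = (\<Sum>i\<in>UNIV. mul (eval2 (c i)) (z.Lfun (B *v axis i 1)))"
proof -
  obtain x0 where x0: "x0 \<in> variety p" "rank (eval_mat Q x0) = CARD('a)"
    using admissible unfolding admissible_kernel_def by blast
  obtain B where B: "eval_mat Q x0 ** B = mat 1" using full_row_rank_right_inverse[OF x0(2)] .
  obtain d where d: "\<And>x. eval2 d x = det (eval_mat Q x ** B)" "\<not> p dvd d"
    using finite_rank_drop[OF x0(1) B] by blast
  obtain A A' r where r: "r \<noteq> 0" "A * d + A' * p = [:r:]"
    using eliminate_outer_variable[OF irred _ d(2)] m_pos deg_w by metis
  have r_eq: "poly r (fst x) = eval2 A x * eval2 d x" if "x \<in> variety p" for x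
  proof -
    have "poly r (fst x) = eval2 (A * d + A' * p) x" by (simp add: r eval2_poly_z)
    also have "\<dots> = eval2 A x * eval2 d x"
      using that by (simp add: eval2_add eval2_mult variety_def zero_set_def)
    finally show ?thesis .
  qed
  have col: "eval_mat Q x *v (B *v axis i 1) = column i (eval_mat Q x ** B)" for x i
    by (simp add: matrix_vector_mul_assoc vec_eq_iff matrix_vector_mult_def matrix_matrix_mult_def column_def axis_def
        if_distrib[of "\<lambda>t. _ * t"] cong: if_cong)
  show ?thesis
  proof (rule that[of "r * r" B])
    show "inj (\<lambda>i. z.Lfun (B *v axis i 1))"
    proof (rule injI)
      fix i j assume "z.Lfun (B *v axis i 1) = z.Lfun (B *v axis j 1)"
      then have "z.Lfun (B *v axis i 1) x0 = z.Lfun (B *v axis j 1) x0" by simp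
      then have "column i (mat 1 :: complex ^ 'a ^ 'a) = column j (mat 1)"
        using x0(1) by (simp add: z.Lfun_def col B)
      then have "(mat 1 :: complex ^ 'a ^ 'a) $ i $ i = mat 1 $ i $ j" by (simp add: column_def vec_eq_iff)
      then show "i = j" by (simp add: mat_def split: if_splits)
    qed
  next
    fix a
    \<comment> \<open>the numerators in Cramer's rule, as polynomials\<close>
    define c where "c k = det (\<chi> i j. if j = k then \<Sum>b\<in>UNIV. Q $ i $ b * [:[:a $ b:]:]
      else \<Sum>b\<in>UNIV. Q $ i $ b * [:[:B $ b $ j:]:])" for k
    have c: "eval2 (c k) x = det (\<chi> i j. if j = k then (eval_mat Q x *v a) $ i else (eval_mat Q x ** B) $ i $ j)" for k x
      unfolding c_def eval2_det
      by (rule arg_cong[where f = det])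
        (simp add: eval_mat_def vec_eq_iff matrix_matrix_mult_def matrix_vector_mult_def eval2_sum eval2_smult mult.commute)
    have "mul (\<lambda>x. poly (r * r) (fst x)) (z.Lfun a) x
        = (\<Sum>i\<in>UNIV. mul (eval2 (A * A * d * c i)) (z.Lfun (B *v axis i 1))) x" for x
    proof (cases "x \<in> variety p \<and> eval2 d x \<noteq> 0")
      case True
      have "poly (r * r) (fst x) *s (eval_mat Q x *v a)
          = (eval2 A x * eval2 A x * eval2 d x) *s (det (eval_mat Q x ** B) *s (eval_mat Q x *v a))"
        using True by (simp add: r_eq d(1)[symmetric] mult_ac)
      also have "\<dots> = (eval2 A x * eval2 A x * eval2 d x) *s
          (\<Sum>k\<in>UNIV. eval2 (c k) x *s column k (eval_mat Q x ** B))"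
        using True cramer_on_columns[of "eval_mat Q x ** B" "eval_mat Q x *v a"] by (simp add: c d(1))
      finally show ?thesis
        using True by (simp add: fun_sum_apply mul_def z.Lfun_def col eval2_mult vec.scale_sum_right)
    next
      case False
      then show ?thesis
        by (auto simp: fun_sum_apply mul_def z.Lfun_def eval2_mult r_eq)
    qed
    then show "\<exists>c. mul (\<lambda>x. poly (r * r) (fst x)) (z.Lfun a) = (\<Sum>i\<in>UNIV. mul (eval2 (c i)) (z.Lfun (B *v axis i 1)))"
      by (intro exI[of _ "\<lambda>i. A * A * d * c i"] ext)
  qed (use r in simp)
qed

lemma Lfun_basis_expansion: "z.Lfun a = (\<Sum>b\<in>UNIV. fun_scale (a $ b) (z.Lfun (axis b 1)))"
proof
  fix x
  have "eval_mat Q x *v a = eval_mat Q x *v (\<Sum>b\<in>UNIV. a $ b *s axis b 1)"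
    by (simp add: basis_expansion)
  then show "z.Lfun a x = (\<Sum>b\<in>UNIV. fun_scale (a $ b) (z.Lfun (axis b 1))) x"
    by (simp add: fun_sum_apply z.Lfun_def fun_scale_def vec.sum matrix_vector_scale)
qed

lemma mul_poly_Lfun_expansion:
  "mul (\<lambda>x. poly t (fst x)) (z.Lfun a)
    = (\<Sum>i\<le>degree t. \<Sum>b\<in>UNIV. fun_scale (coeff t i * a $ b) (mul (\<lambda>x. fst x ^ i) (z.Lfun (axis b 1))))"
proof
  fix x
  have "mul (\<lambda>x. poly t (fst x)) (z.Lfun a) x
      = (\<Sum>i\<le>degree t. coeff t i * fst x ^ i) *s (\<Sum>b\<in>UNIV. a $ b *s z.Lfun (axis b 1) x)"
    by (subst Lfun_basis_expansion) (simp add: mul_def poly_altdef fun_sum_apply fun_scale_def)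
  also have "\<dots> = (\<Sum>i\<le>degree t. \<Sum>b\<in>UNIV. (coeff t i * a $ b) *s (fst x ^ i *s z.Lfun (axis b 1) x))"
    unfolding vec.scale_sum_left by (simp add: vec.scale_sum_right mult_ac)
  finally show "mul (\<lambda>x. poly t (fst x)) (z.Lfun a) x
    = (\<Sum>i\<le>degree t. \<Sum>b\<in>UNIV. fun_scale (coeff t i * a $ b) (mul (\<lambda>x. fst x ^ i) (z.Lfun (axis b 1)))) x"
    by (simp add: fun_sum_apply fun_scale_def mul_def)
qed

text \<open>
  A function orthogonal to the module is orthogonal to \<open>s r Q a\<close> for all \<open>s \<in> \<complex>[z]\<close>; if it is also orthogonal to
  \<open>z\<^sup>k Q e\<^sub>b\<close> for \<open>k \<le> deg r\<close>, then division by \<open>r\<close> shows that it is orthogonal to \<open>z\<^sup>k Q a\<close> for every \<open>k\<close> and \<open>a\<close>.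
\<close>

lemma at_most_nearly_cyclic_mult: "at_most_nearly_cyclic mult_z mult_w CARD('a)"
proof -
  obtain r and B :: "complex ^ 'a ^ 'b" where r: "r \<noteq> 0" and inj: "inj (\<lambda>i. z.Lfun (B *v axis i 1))"
    and gen: "\<And>a. \<exists>c. mul (\<lambda>x. poly r (fst x)) (z.Lfun a) = (\<Sum>i\<in>UNIV. mul (eval2 (c i)) (z.Lfun (B *v axis i 1)))"
    by (rule clear_into_generators) (rule that, assumption+)
  obtain idx :: "nat \<Rightarrow> 'a" where idx: "bij_betw idx {..<CARD('a)} UNIV"
    using ex_bij_betw_nat_finite[of "UNIV :: 'a set"] by (auto simp: lessThan_atLeast0)
  define f where "f j = z.Lfun (B *v axis (idx j) 1)" for j
  have f_inj: "inj_on f {..<CARD('a)}"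
    using idx inj unfolding f_def bij_betw_def inj_on_def by blast
  have fH: "f ` {..<CARD('a)} \<subseteq> H" by (auto simp: f_def z.Lfun_in)
  let ?N = "cyclic_span mult_z mult_w CARD('a) f"
  have inN: "mul (\<lambda>x. poly (s * r) (fst x)) (z.Lfun a) \<in> ?N" for s a
  proof -
    obtain c where c: "mul (\<lambda>x. poly r (fst x)) (z.Lfun a) = (\<Sum>i\<in>UNIV. mul (eval2 (c i)) (z.Lfun (B *v axis i 1)))"
      using gen by blast
    have "mul (\<lambda>x. poly (s * r) (fst x)) (z.Lfun a) = mul (\<lambda>x. poly s (fst x)) (mul (\<lambda>x. poly r (fst x)) (z.Lfun a))"
      by (simp add: mul_mul)
    also have "\<dots> = (\<Sum>i\<in>UNIV. mul (eval2 ([:s:] * c i)) (z.Lfun (B *v axis i 1)))"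
      unfolding c by (simp add: fun_eq_iff mul_def fun_sum_apply eval2_smult vec.scale_sum_right)
    also have "\<dots> = (\<Sum>j<CARD('a). mul (eval2 ([:s:] * c (idx j))) (f j))"
      unfolding f_def by (rule sum.reindex_bij_betw[OF idx, symmetric])
    finally show ?thesis unfolding cyclic_span_eq by (intro CollectI exI[of _ "\<lambda>j. [:s:] * c (idx j)"]) simp
  qed
  define F where "F = (\<lambda>(k, b). mul (\<lambda>x. fst x ^ k) (z.Lfun (axis b 1))) ` ({..degree r} \<times> UNIV)"
  have pw: "mul (\<lambda>x. fst x ^ k) g \<in> H" if "g \<in> H" for k g
    using that mul_eval2_closed[of g "[:monom 1 k:]"] by (simp add: eval2_poly_z[abs_def] poly_monom)
  have "finite_codim (mtopology closure_of ?N)"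
  proof (rule finite_codim_closure[of F])
    show "finite F" by (simp add: F_def)
    show "F \<subseteq> H" by (auto simp: F_def intro!: pw z.Lfun_in)
    show "subspace ?N" by (rule subspace_cyclic_span)
    show "?N \<subseteq> H" by (rule cyclic_span_subset[OF fH])
    fix h assume hN: "h \<in> perp ?N" and hF: "h \<in> perp F"
    have h: "h \<in> H" using hN by (simp add: perp_def)
    show "h = 0"
    proof (rule z.perp_powers_imp_zero[OF h])
      fix k a
      let ?t = "monom 1 k mod r" and ?s = "monom 1 k div r"
      have t0: "ip (mul (\<lambda>x. poly ?t (fst x)) (z.Lfun a)) h = 0"
      proof -
        have "degree ?t \<le> degree r" using degree_mod_less'[of r "monom 1 k"] r by (cases "?t = 0") auto
        then have "ip (mul (\<lambda>x. fst x ^ i) (z.Lfun (axis b 1))) h = 0" if "i \<le> degree ?t" for i b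
          using hF that by (auto simp: perp_def F_def)
        then show ?thesis
          unfolding mul_poly_Lfun_expansion using h pw[OF z.Lfun_in]
          by (simp add: ip_sum H_sum H_scale ip_scale)
      qed
      have s0: "ip (mul (\<lambda>x. poly (?s * r) (fst x)) (z.Lfun a)) h = 0"
        using hN inN by (simp add: perp_def)
      have split: "mul (\<lambda>x. fst x ^ k) (z.Lfun a)
          = mul (\<lambda>x. poly (?s * r) (fst x)) (z.Lfun a) + mul (\<lambda>x. poly ?t (fst x)) (z.Lfun a)"
      proof -
        have eq: "x ^ k = poly (?s * r) x + poly ?t x" for x
          by (metis div_mult_mod_eq mult_1 poly_add poly_monom)
        show ?thesis by (rule ext) (simp only: mul_def plus_fun_apply eq vec.scale_left_distrib)
      qed
      have closed: "mul (\<lambda>x. poly u (fst x)) (z.Lfun a) \<in> H" for u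
        using mul_eval2_closed[OF z.Lfun_in, of "[:u:]" a] by (simp add: eval2_poly_z[abs_def])
      have "ip (mul (\<lambda>x. fst x ^ k) (z.Lfun a)) h = 0"
        by (simp only: split ip_add[OF closed closed h] s0 t0) simp
      then show "ip h (mul (\<lambda>x. fst x ^ k) (z.Lfun a)) = 0"
        using ip_cnj[OF pw[OF z.Lfun_in] h] by simp
    qed
  qed
  then show ?thesis
    unfolding at_most_nearly_cyclic_def using commuting_isometries_mult f_inj fH by blast
qed

end

theorem theorem4p9:
  fixes p :: "complex poly poly"
    and n m \<alpha> :: nat
    and Q :: "complex poly poly ^ 'b ^ 'a"
    and P :: "complex poly poly ^ 'c ^ 'a"
    and K :: "complex \<times> complex \<Rightarrow> complex \<times> complex \<Rightarrow> complex ^ 'a ^ 'a"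
    and H :: "(complex \<times> complex \<Rightarrow> complex ^ 'a) set"
    and ip :: "(complex \<times> complex \<Rightarrow> complex ^ 'a) \<Rightarrow> (complex \<times> complex \<Rightarrow> complex ^ 'a) \<Rightarrow> complex"
  assumes "irreducible p"
    and "inner_toral p"
    and "has_bidegree p n m"
    and "0 < \<alpha>"
    and "admissible_kernel p n m \<alpha> Q P K"
    and "rkhs H ip (variety p) K"
  shows "complex_hilbert_space.nearly_cyclic fun_scale H ip mult_z mult_w \<alpha>"
proof -
  have card: "\<alpha> = CARD('a)" "CARD('b) = m * \<alpha>" "CARD('c) = n * \<alpha>"
    using assms(5) by (auto simp: admissible_kernel_def)
  have "0 < CARD('b)" "0 < CARD('c)" by (rule zero_less_card_finite)+
  then have "0 < m" "0 < n" using card by (auto intro: gr0I)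
  interpret rkhs H ip "variety p" K by fact
  interpret admissible_rkhs p n m H ip K Q P
    using assms(1-3,5) \<open>0 < m\<close> \<open>0 < n\<close> card(1) by unfold_locales auto
  show ?thesis
    using at_most_nearly_cyclic_mult at_least_nearly_cyclic_mult by (simp add: nearly_cyclic_def card(1))
qed

end
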